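(* Let $p\ge 2$ and let ${\bf A}$ be a unipotent $\mathbb{Z}^p$-action on $\mathbb{Z}^3$ written in the form $${\bf A}(\ell)(x,y,z)=(x,\ \mu(\ell)x+y,\ \omega(\ell)x+\nu(\ell)y+z),\qquad \ell\in\mathbb{Z}^p,$$ with maps $\mu,\nu,\omega:\mathbb{Z}^p\to\mathbb{Z}$ (so that $\mu$ and $\nu$ are homomorphisms, and $\omega$ is a homomorphism whenever $\mu=0$ or $\nu=0$). Then there exists a minimal free affine $\mathbb{Z}^p$-action $\psi$ on $T^3$ with $\psi_*={\bf A}$ if and only if it is not the case that $\nu=0$ and $\{\mu,\omega\}$ is linearly independent over $\mathbb{Q}$.
   Context: A $\mathbb{Z}^p$-action on $\mathbb{Z}^3$ is a homomorphism ${\bf A}:\mathbb{Z}^p\to\mathrm{Aut}(\mathbb{Z}^3)=GL(3,\mathbb{Z})$; it is unipotent if every ${\bf A}(\ell)$ is unipotent. Every unipotent $\mathbb{Z}^p$-action on $\mathbb{Z}^3$ has the displayed form in a suitable basis of $\mathbb{Z}^3$. Let $T^3=\mathbb{R}^3/\mathbb{Z}^3$ and let $\mathrm{Affine}(T^3)$ be the group of affine transformations ${\bf x}\mapsto B{\bf x}+{\bf a}$ of $T^3$, with $B\in GL(3,\mathbb{Z})$ and ${\bf a}\in T^3$. An affine $\mathbb{Z}^p$-action on $T^3$ is a homomorphism $\psi:\mathbb{Z}^p\to\mathrm{Affine}(T^3)$; $\psi_*$ denotes the induced $\mathbb{Z}^p$-action on $H_1(T^3,\mathbb{Z})=\mathbb{Z}^3$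 (the linear part of $\psi$). The action $\psi$ is free if $\psi(\ell)$ has no fixed point on $T^3$ for every $\ell\in\mathbb{Z}^p-\{0\}$, and minimal if every orbit $\{\psi(\ell)({\bf x}):\ell\in\mathbb{Z}^p\}$ is dense in $T^3$. Linear independence over $\mathbb{Q}$ of homomorphisms $\mathbb{Z}^p\to\mathbb{Z}$ is meant in the $\mathbb{Q}$-vector space $\mathrm{Hom}(\mathbb{Z}^p,\mathbb{Q})$. *)

theory Defs
  imports "HOL-Analysis.Analysis"
begin

section \<open>The torus \<open>T\<^sup>3 = \<real>\<^sup>3 / \<int>\<^sup>3\<close>\<close>

definition torus_rel :: "real ^ 3 \<Rightarrow> real ^ 3 \<Rightarrow> bool" where
  "torus_rel x y \<longleftrightarrow> (\<forall>i. x $ i - y $ i \<in> \<int>)"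

lemma equivp_torus_rel: "equivp torus_rel"
proof (rule equivpI)
  show "reflp torus_rel"
    by (simp add: reflp_def torus_rel_def)
  show "symp torus_rel"
    unfolding symp_def torus_rel_def by (metis Ints_minus minus_diff_eq)
  show "transp torus_rel"
    unfolding transp_def torus_rel_def
  proof (intro allI impI)
    fix x y z :: "real ^ 3" and i
    assume "\<forall>i. x $ i - y $ i \<in> \<int>" "\<forall>i. y $ i - z $ i \<in> \<int>"
    then have "(x $ i - y $ i) + (y $ i - z $ i) \<in> \<int>"
      by (intro Ints_add) auto
    then show "x $ i - z $ i \<in> \<int>"
      by simp
  qed
qed

quotient_type torus3 = "real ^ 3" / torus_rel
  by (rule equivp_torus_rel)

instantiation torus3 :: topological_space
begin

definition open_torus3 :: "torus3 set \<Rightarrow> bool" where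
  "open_torus3 U \<longleftrightarrow> open (abs_torus3 -` U)"

instance
  by standard (auto simp: open_torus3_def vimage_Union intro: open_Int)

end

instantiation torus3 :: ab_group_add
begin

lift_definition zero_torus3 :: torus3 is "0" .

lift_definition plus_torus3 :: "torus3 \<Rightarrow> torus3 \<Rightarrow> torus3" is "(+)"
  unfolding torus_rel_def by (metis Ints_add add_diff_add vector_add_component)

lift_definition uminus_torus3 :: "torus3 \<Rightarrow> torus3" is "uminus"
  unfolding torus_rel_def by (metis Ints_minus minus_diff_eq minus_diff_minus vector_uminus_component)

definition minus_torus3 :: "torus3 \<Rightarrow> torus3 \<Rightarrow> torus3" where
  "minus_torus3 a b = a + - b"

instance
proof
  fix a b c :: torus3
  show "a + b + c = a + (b + c)"
    by transfer (simp add: torus_rel_def)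
  show "a + b = b + a"
    by transfer (simp add: torus_rel_def)
  show "0 + a = a"
    by transfer (simp add: torus_rel_def)
  show "- a + a = 0"
    by transfer (simp add: torus_rel_def)
  show "a - b = a + - b"
    by (fact minus_torus3_def)
qed

end


section \<open>Affine transformations\<close>

definition real_matrix :: "int ^ 3 ^ 3 \<Rightarrow> real ^ 3 ^ 3" where
  "real_matrix B = (\<chi> i j. of_int (B $ i $ j))"

lift_definition torus_mult :: "int ^ 3 ^ 3 \<Rightarrow> torus3 \<Rightarrow> torus3"
  is "\<lambda>B x. real_matrix B *v x"
proof -
  fix B :: "int ^ 3 ^ 3" and x y :: "real ^ 3"
  assume "torus_rel x y"
  then have *: "x $ i - y $ i \<in> \<int>" for i
    by (simp add: torus_rel_def)
  have "(real_matrix B *v x) $ i - (real_matrix B *v y) $ i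
      = (\<Sum>j\<in>UNIV. of_int (B $ i $ j) * (x $ j - y $ j))" for i
    by (simp add: matrix_vector_mult_def real_matrix_def right_diff_distrib sum_subtractf)
  also have "(\<Sum>j\<in>UNIV. of_int (B $ i $ j) * (x $ j - y $ j)) \<in> \<int>" for i
    by (intro Ints_sum Ints_mult * Ints_of_int)
  finally show "torus_rel (real_matrix B *v x) (real_matrix B *v y)"
    by (simp add: torus_rel_def)
qed

definition affine_map :: "int ^ 3 ^ 3 \<Rightarrow> torus3 \<Rightarrow> torus3 \<Rightarrow> torus3" where
  "affine_map B a = (\<lambda>x. torus_mult B x + a)"

text \<open>For integer matrices \<open>invertible\<close> means having an integral inverse, so that
  \<open>{B. invertible B}\<close> is \<open>GL(3, \<int>)\<close>.\<close>

definition affine_T3 :: "(torus3 \<Rightarrow> torus3) set" where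
  "affine_T3 = {affine_map B a | B a. invertible B}"

lemma affine_map_inject:
  assumes "affine_map B a = affine_map C c"
  shows "B = C"
proof -
  have eq: "torus_mult B x + a = torus_mult C x + c" for x
    using assms by (auto simp: affine_map_def fun_eq_iff)
  have z: "torus_mult D 0 = 0" for D
    by transfer (simp add: torus_rel_def)
  have "a = c"
    using eq[of 0] by (simp add: z)
  then have eq': "torus_mult B x = torus_mult C x" for x
    using eq[of x] by simp
  have int: "(real_matrix B *v x) $ i - (real_matrix C *v x) $ i \<in> \<int>" for x i
  proof -
    have "torus_mult B (abs_torus3 x) = torus_mult C (abs_torus3 x)"
      by (rule eq')
    then show ?thesis
      by (simp add: torus_mult.abs_eq torus3.abs_eq_iff torus_rel_def)
  qed
  have "B $ i $ j = C $ i $ j" for i j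
  proof -
    define d :: real where "d = of_int (B $ i $ j) - of_int (C $ i $ j)"
    define t :: real where "t = 1 / (2 * \<bar>d\<bar> + 1)"
    have "(real_matrix D *v axis j t) $ i = of_int (D $ i $ j) * t" for D
      by (simp add: matrix_vector_mult_def real_matrix_def axis_def if_distrib cong: if_cong)
    then have "d * t \<in> \<int>"
      using int[of "axis j t" i] by (simp add: d_def left_diff_distrib)
    moreover have "\<bar>d * t\<bar> < 1"
      by (simp add: t_def abs_mult)
    ultimately have "d * t = 0"
      by (metis Ints_nonzero_abs_less1)
    then have "d = 0"
      by (simp add: t_def add_nonneg_eq_0_iff)
    then show ?thesis
      by (simp add: d_def)
  qed
  then show ?thesis
    by (simp add: vec_eq_iff)
qed

definition linear_part :: "(torus3 \<Rightarrow> torus3) \<Rightarrow> int ^ 3 ^ 3" where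
  "linear_part f = (THE B. \<exists>a. f = affine_map B a)"

lemma linear_part_affine_map [simp]: "linear_part (affine_map B a) = B"
  unfolding linear_part_def by (rule the_equality) (auto dest: affine_map_inject)


section \<open>Actions of \<open>\<int>\<^sup>p\<close>\<close>

text \<open>The group \<open>\<int>\<^sup>p\<close> is the type \<open>int ^ 'p\<close>, with \<open>p = CARD('p)\<close>.\<close>

definition linear_action :: "(int ^ 'p \<Rightarrow> int ^ 3 ^ 3) \<Rightarrow> bool" where
  "linear_action A \<longleftrightarrow>
    (\<forall>l. invertible (A l)) \<and> A 0 = mat 1 \<and> (\<forall>k l. A (k + l) = A k ** A l)"

definition unipotent :: "int ^ 3 ^ 3 \<Rightarrow> bool" where
  "unipotent B \<longleftrightarrow> (\<exists>n. (((**) (B - mat 1)) ^^ n) (mat 1) = 0)"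

definition unipotent_action :: "(int ^ 'p \<Rightarrow> int ^ 3 ^ 3) \<Rightarrow> bool" where
  "unipotent_action A \<longleftrightarrow> linear_action A \<and> (\<forall>l. unipotent (A l))"

definition affine_action :: "(int ^ 'p \<Rightarrow> torus3 \<Rightarrow> torus3) \<Rightarrow> bool" where
  "affine_action \<psi> \<longleftrightarrow>
    (\<forall>l. \<psi> l \<in> affine_T3) \<and> \<psi> 0 = id \<and> (\<forall>k l. \<psi> (k + l) = \<psi> k \<circ> \<psi> l)"

text \<open>The action induced on \<open>H\<^sub>1(T\<^sup>3, \<int>) = \<int>\<^sup>3\<close>: the map induced by
  \<open>x \<mapsto> B x + a\<close> is multiplication by \<open>B\<close>.\<close>

definition induced_action ::
    "(int ^ 'p \<Rightarrow> torus3 \<Rightarrow> torus3) \<Rightarrow> int ^ 'p \<Rightarrow> int ^ 3 ^ 3" where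
  "induced_action \<psi> = (\<lambda>l. linear_part (\<psi> l))"

definition free_action :: "(int ^ 'p \<Rightarrow> torus3 \<Rightarrow> torus3) \<Rightarrow> bool" where
  "free_action \<psi> \<longleftrightarrow> (\<forall>l. l \<noteq> 0 \<longrightarrow> (\<nexists>x. \<psi> l x = x))"

definition minimal_action :: "(int ^ 'p \<Rightarrow> torus3 \<Rightarrow> torus3) \<Rightarrow> bool" where
  "minimal_action \<psi> \<longleftrightarrow> (\<forall>x. closure (range (\<lambda>l. \<psi> l x)) = UNIV)"

text \<open>Linear independence of the pair \<open>(f, g)\<close>, as a family rather than as a set: the pair
  \<open>(f, f)\<close> is always dependent.\<close>

definition lin_indep_Q :: "(int ^ 'p \<Rightarrow> int) \<Rightarrow> (int ^ 'p \<Rightarrow> int) \<Rightarrow> bool" where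
  "lin_indep_Q f g \<longleftrightarrow>
    (\<forall>a b :: rat. (\<forall>l. a * of_int (f l) + b * of_int (g l) = 0) \<longrightarrow> a = 0 \<and> b = 0)"

end

theory Submission
  imports Defs
begin

text \<open>
  Necessity. If \<open>\<nu> = 0\<close> and \<open>\<mu>, \<omega>\<close> are independent, some determinant \<open>D = \<mu>(k) \<omega>(l) - \<mu>(l) \<omega>(k)\<close>
  is nonzero. Commutativity of the action forces \<open>D a(m) = 0\<close> in \<open>\<real>/\<int>\<close> for the first coordinate
  \<open>a(m)\<close> of every translation part, so the first coordinate of the orbit of \<open>0\<close> takes only finitely
  many values.

  Sufficiency. In every other case the translation part is an explicit real cocycle with generic
  coefficients, and a single element \<open>l0\<close> already acts minimally. Its action is a tower of circle
  extensions over a rotation, minimal by Kronecker's theorem. Each extension is minimal for the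
  following reason. Over a point \<open>v\<close> the return displacements in the fibre form a closed subgroup of
  \<open>\<real>/\<int>\<close>. If \<open>n\<close> is a large return time, the linear part of the \<open>n\<close>-th iterate turns a small
  displacement \<open>t u\<close> of the base point into a fibre displacement \<open>t\<close>. Choosing a time \<open>k\<close> that moves
  \<open>v\<close> close to \<open>v + t u\<close>, the returns at times \<open>n\<close>, \<open>k\<close> and \<open>n + k\<close> have displacements \<open>s\<close>, \<open>s'\<close>
  and \<open>s + s' + t\<close>. Hence \<open>t\<close> lies in the subgroup, for every \<open>t\<close>.
\<close>

section \<open>Minimality modulo a subgroup\<close>

text \<open>All dynamics takes place on lifts to the universal cover. This is closeness in the
  quotient by \<open>L\<close>, expressed without a quotient type or a quotient metric.\<close>

definition near_mod :: "'v::real_normed_vector set \<Rightarrow> real \<Rightarrow> 'v \<Rightarrow> 'v \<Rightarrow> bool" where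
  "near_mod L e v w \<longleftrightarrow> (\<exists>d\<in>L. norm (v - w - d) < e)"

text \<open>Only forward orbits count, so no inverse of \<open>F\<close> is needed. The price is
  that closure of the return displacements under negation requires an argument,
  \<open>returns_minus\<close>.\<close>

definition minimal_mod :: "'v::real_normed_vector set \<Rightarrow> ('v \<Rightarrow> 'v) \<Rightarrow> bool" where
  "minimal_mod L F \<longleftrightarrow> (\<forall>v w. \<forall>e>0. \<exists>k. near_mod L e ((F ^^ k) v) w)"

text \<open>Besides continuity this contains compatibility with the quotients: if
  \<open>w - v\<close> lies in \<open>L\<close>, then \<open>F w\<close> is arbitrarily close to
  \<open>F v\<close> modulo \<open>M\<close>.\<close>

definition cont_mod ::
    "'v::real_normed_vector set \<Rightarrow> 'w::real_normed_vector set \<Rightarrow> ('v \<Rightarrow> 'w) \<Rightarrow> bool" where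
  "cont_mod L M F \<longleftrightarrow>
    (\<forall>v. \<forall>e>0. \<exists>d>0. \<forall>w. near_mod L d w v \<longrightarrow> near_mod M e (F w) (F v))"

lemma cont_modE:
  assumes "cont_mod L M F" "e > 0"
  obtains d where "d > 0" "\<And>w. near_mod L d w v \<Longrightarrow> near_mod M e (F w) (F v)"
  using assms unfolding cont_mod_def by blast

locale add_subgroup =
  fixes L :: "'v::real_normed_vector set"
  assumes zero_mem: "0 \<in> L"
    and diff_mem: "\<And>x y. x \<in> L \<Longrightarrow> y \<in> L \<Longrightarrow> x - y \<in> L"
begin

lemma minus_mem: "x \<in> L \<Longrightarrow> - x \<in> L"
  using diff_mem[OF zero_mem] by simp

lemma add_mem: "x \<in> L \<Longrightarrow> y \<in> L \<Longrightarrow> x + y \<in> L"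
  using diff_mem[of x "- y"] minus_mem by simp

lemma near_mod_norm: "norm (v - w) < e \<Longrightarrow> near_mod L e v w"
  unfolding near_mod_def using zero_mem by (intro bexI[of _ 0]) auto

lemma near_mod_refl: "e > 0 \<Longrightarrow> near_mod L e v v"
  by (simp add: near_mod_norm)

lemma near_mod_trans:
  assumes "near_mod L e v w" "near_mod L e' w u" "e + e' \<le> e''"
  shows "near_mod L e'' v u"
proof -
  obtain d d' where d: "d \<in> L" "norm (v - w - d) < e" "d' \<in> L" "norm (w - u - d') < e'"
    using assms unfolding near_mod_def by blast
  have "norm (v - u - (d + d')) = norm ((v - w - d) + (w - u - d'))"
    by (simp add: algebra_simps)
  also have "\<dots> < e''"
    using norm_triangle_ineq[of "v - w - d" "w - u - d'"] d assms(3) by linarith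
  finally show ?thesis
    using d add_mem unfolding near_mod_def by blast
qed

lemma near_mod_add:
  assumes "near_mod L e v w" "near_mod L e' v' w'" "e + e' \<le> e''"
  shows "near_mod L e'' (v + v') (w + w')"
proof -
  have "near_mod L e (v + v') (w + v')" "near_mod L e' (w + v') (w + w')"
    using assms(1,2) by (simp_all add: near_mod_def)
  then show ?thesis
    using near_mod_trans assms(3) by blast
qed

lemma near_mod_mono: "near_mod L e v w \<Longrightarrow> e \<le> e' \<Longrightarrow> near_mod L e' v w"
  unfolding near_mod_def by force

end

interpretation Z: add_subgroup "\<int> :: real set"
  by unfold_locales auto

lemma cont_mod_funpow:
  assumes "cont_mod L L F"
  shows "cont_mod L L (F ^^ n)"
proof (induction n)
  case 0
  then show ?case by (auto simp: cont_mod_def)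
next
  case (Suc n)
  show ?case
    unfolding cont_mod_def
  proof (intro allI impI)
    fix v :: 'a and e :: real assume "e > 0"
    obtain d where d: "d > 0" "\<And>w. near_mod L d w ((F ^^ n) v) \<Longrightarrow> near_mod L e (F w) (F ((F ^^ n) v))"
      using cont_modE[OF assms \<open>e > 0\<close>] by metis
    obtain d' where "d' > 0" "\<And>w. near_mod L d' w v \<Longrightarrow> near_mod L d ((F ^^ n) w) ((F ^^ n) v)"
      using cont_modE[OF Suc \<open>d > 0\<close>] by metis
    then show "\<exists>d>0. \<forall>w. near_mod L d w v \<longrightarrow> near_mod L e ((F ^^ Suc n) w) ((F ^^ Suc n) v)"
      using d by auto
  qed
qed

text \<open>A point near \<open>v\<close> modulo \<open>L\<close> is an \<open>L\<close>-translate
  of a point truly near \<open>v\<close>, and undoing the translation changes the value of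
  \<open>F\<close> only by an element of \<open>M\<close>.\<close>

lemma cont_modI:
  fixes F :: "'v::real_normed_vector \<Rightarrow> 'w::real_normed_vector"
  assumes "continuous_on UNIV F" "\<And>v d. d \<in> L \<Longrightarrow> F (v + d) - F v \<in> M"
  shows "cont_mod L M F"
  unfolding cont_mod_def
proof (intro allI impI)
  fix v :: 'v and e :: real assume "e > 0"
  then obtain d where d: "d > 0" "\<And>w. dist w v < d \<Longrightarrow> dist (F w) (F v) < e"
    using assms(1) unfolding continuous_on_iff by (metis UNIV_I)
  have "near_mod M e (F w) (F v)" if "near_mod L d w v" for w
  proof -
    obtain l where l: "l \<in> L" "norm (w - v - l) < d"
      using \<open>near_mod L d w v\<close> by (auto simp: near_mod_def)
    have "dist (F (w - l)) (F v) < e"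
      using l by (intro d) (simp add: dist_norm algebra_simps)
    moreover have "F w - F (w - l) \<in> M"
      using assms(2)[OF l(1), of "w - l"] by simp
    ultimately show ?thesis
      unfolding near_mod_def by (intro bexI[of _ "F w - F (w - l)"]) (auto simp: dist_norm)
  qed
  then show "\<exists>d>0. \<forall>w. near_mod L d w v \<longrightarrow> near_mod M e (F w) (F v)"
    using d by blast
qed

section \<open>Circle extensions of minimal maps\<close>

definition skew :: "('v \<Rightarrow> 'v) \<Rightarrow> ('v \<Rightarrow> real) \<Rightarrow> 'v \<times> real \<Rightarrow> 'v \<times> real" where
  "skew F g = (\<lambda>(v, z). (F v, z + g v))"

definition birkhoff_sum :: "('v \<Rightarrow> 'v) \<Rightarrow> ('v \<Rightarrow> real) \<Rightarrow> nat \<Rightarrow> 'v \<Rightarrow> real" where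
  "birkhoff_sum F g n v = (\<Sum>i<n. g ((F ^^ i) v))"

lemma birkhoff_sum_Suc: "birkhoff_sum F g (Suc n) v = birkhoff_sum F g n v + g ((F ^^ n) v)"
  by (simp add: birkhoff_sum_def)

lemma skew_funpow: "(skew F g ^^ n) (v, z) = ((F ^^ n) v, z + birkhoff_sum F g n v)"
  by (induction n) (simp_all add: skew_def birkhoff_sum_def)

lemma birkhoff_sum_add:
  "birkhoff_sum F g (n + k) v = birkhoff_sum F g k v + birkhoff_sum F g n ((F ^^ k) v)"
  by (induction n) (simp_all add: birkhoff_sum_def funpow_add)

lemma cont_mod_birkhoff_sum:
  assumes "cont_mod L L F" "cont_mod L \<int> g"
  shows "cont_mod L \<int> (birkhoff_sum F g n)"
proof (induction n)
  case 0
  then show ?case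
    by (auto simp: cont_mod_def birkhoff_sum_def intro!: Z.near_mod_refl exI[of _ 1])
next
  case (Suc n)
  show ?case
    unfolding cont_mod_def
  proof (intro allI impI)
    fix v :: 'a and e :: real assume "e > 0"
    then have "e / 2 > 0" by simp
    obtain d where d: "d > 0"
      "\<And>w. near_mod L d w v \<Longrightarrow> near_mod \<int> (e/2) (birkhoff_sum F g n w) (birkhoff_sum F g n v)"
      using cont_modE[OF Suc \<open>e / 2 > 0\<close>] by metis
    obtain c where c: "c > 0"
      "\<And>w. near_mod L c w ((F ^^ n) v) \<Longrightarrow> near_mod \<int> (e/2) (g w) (g ((F ^^ n) v))"
      using cont_modE[OF assms(2) \<open>e / 2 > 0\<close>] by metis
    obtain c' where c': "c' > 0"
      "\<And>w. near_mod L c' w v \<Longrightarrow> near_mod L c ((F ^^ n) w) ((F ^^ n) v)"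
      using cont_modE[OF cont_mod_funpow[OF assms(1)] \<open>c > 0\<close>] by metis
    have "near_mod \<int> e (birkhoff_sum F g (Suc n) w) (birkhoff_sum F g (Suc n) v)"
      if "near_mod L (min d c') w v" for w
    proof -
      have "near_mod L d w v" "near_mod L c' w v"
        using that unfolding near_mod_def by force+
      then show ?thesis
        unfolding birkhoff_sum_Suc using d c c'
        by (intro Z.near_mod_add[where e="e/2" and e'="e/2"]) auto
    qed
    then show "\<exists>d>0. \<forall>w. near_mod L d w v \<longrightarrow>
        near_mod \<int> e (birkhoff_sum F g (Suc n) w) (birkhoff_sum F g (Suc n) v)"
      using d c' by (intro exI[of _ "min d c'"]) auto
  qed
qed

text \<open>The assumption \<open>shear\<close> ties the fibre to the base. In the applications
  shifts along \<open>u\<close> commute with \<open>F\<close>, and \<open>g\<close> is affine with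
  nonzero slope in that direction. The \<open>n\<close>-step sum multiplies this slope by
  \<open>n\<close>, so a vector \<open>u\<close> of length of order 1/n produces a unit
  displacement.\<close>

locale skew_product = add_subgroup L for L :: "'v::real_normed_vector set" +
  fixes F :: "'v \<Rightarrow> 'v" and g :: "'v \<Rightarrow> real"
  assumes base_minimal: "minimal_mod L F"
    and cont_base: "cont_mod L L F"
    and cont_fibre: "cont_mod L \<int> g"
    and shear: "\<And>e. e > 0 \<Longrightarrow> \<exists>J. \<forall>n\<ge>J. \<exists>u. norm u < e \<and>
      (\<forall>v t. (F ^^ n) (v + t *\<^sub>R u) = (F ^^ n) v + t *\<^sub>R u \<and>
        birkhoff_sum F g n (v + t *\<^sub>R u) = birkhoff_sum F g n v + t)"
begin

section \<open>Fibre displacements at near-return times\<close>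

abbreviation "G \<equiv> birkhoff_sum F g"

text \<open>Minimality is applied to the starting point \<open>(F ^^ J) v\<close>, which forces the
  return time of \<open>v\<close> to be at least \<open>J\<close>.\<close>

lemma recurrence:
  assumes "e > 0"
  obtains n where "n \<ge> J" "near_mod L e ((F ^^ n) v) v"
proof -
  obtain k where "near_mod L e ((F ^^ k) ((F ^^ J) v)) v"
    using base_minimal assms unfolding minimal_mod_def by blast
  then show ?thesis
    using that[of "k + J"] by (simp add: funpow_add)
qed

text \<open>Equivalently, for every \<open>z\<close> the point \<open>(v, z + t)\<close> lies in the
  closure of the forward orbit of \<open>(v, z)\<close> modulo
  \<open>L \<times> \<int>\<close>.\<close>

definition returns :: "'v \<Rightarrow> real set" where
  "returns v = {t. \<forall>e>0. \<exists>k. near_mod L e ((F ^^ k) v) v \<and> near_mod \<int> e (G k v) t}"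

lemma returns_approx:
  assumes "\<And>e. e > 0 \<Longrightarrow> \<exists>s\<in>returns v. near_mod \<int> e s t"
  shows "t \<in> returns v"
  unfolding returns_def
proof (intro CollectI allI impI)
  fix e :: real assume "e > 0"
  then obtain s where s: "s \<in> returns v" "near_mod \<int> (e/2) s t"
    using assms[of "e/2"] by auto
  obtain k where k: "near_mod L (e/2) ((F ^^ k) v) v" "near_mod \<int> (e/2) (G k v) s"
    using s(1) \<open>e > 0\<close> unfolding returns_def by (auto dest: spec[of _ "e/2"])
  then show "\<exists>k. near_mod L e ((F ^^ k) v) v \<and> near_mod \<int> e (G k v) t"
    using s(2) \<open>e > 0\<close>
    by (intro exI[of _ k] conjI near_mod_mono[OF k(1)] Z.near_mod_trans[OF k(2) s(2)]) auto
qed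

text \<open>The near-return of time \<open>n\<close> is made first. Continuity of
  \<open>F ^^ k\<close> and \<open>G k\<close> at \<open>v\<close> then keeps the remaining
  \<open>k\<close> steps close to the first \<open>k\<close> steps of \<open>v\<close> itself, so a
  return displacement can be inserted at any stage of the orbit.\<close>

lemma returns_shift:
  assumes "t \<in> returns v" "e > 0"
  obtains n where "near_mod L e ((F ^^ (k + n)) v) ((F ^^ k) v)"
    "near_mod \<int> e (G (k + n) v) (G k v + t)"
proof -
  have "e / 2 > 0" using assms by simp
  obtain d where d: "d > 0" "\<And>w. near_mod L d w v \<Longrightarrow> near_mod L e ((F ^^ k) w) ((F ^^ k) v)"
    using cont_modE[OF cont_mod_funpow[OF cont_base] \<open>e > 0\<close>] by metis
  obtain d' where d': "d' > 0" "\<And>w. near_mod L d' w v \<Longrightarrow> near_mod \<int> (e/2) (G k w) (G k v)"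
    using cont_modE[OF cont_mod_birkhoff_sum[OF cont_base cont_fibre] \<open>e / 2 > 0\<close>] by metis
  define c where "c = min (min d d') (e/2)"
  have "c > 0" using d d' assms by (simp add: c_def)
  then obtain n where n: "near_mod L c ((F ^^ n) v) v" "near_mod \<int> c (G n v) t"
    using assms(1) unfolding returns_def by blast
  have "near_mod L d ((F ^^ n) v) v" "near_mod L d' ((F ^^ n) v) v" "near_mod \<int> (e/2) (G n v) t"
    using near_mod_mono[OF n(1)] Z.near_mod_mono[OF n(2)] by (auto simp: c_def)
  then show ?thesis
    using that[of n] d d'
      Z.near_mod_add[of "e/2" "G k ((F ^^ n) v)" "G k v" "e/2" "G n v" t e]
    by (simp add: funpow_add birkhoff_sum_add add.commute)
qed

lemma returns_zero: "0 \<in> returns v"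
  unfolding returns_def
  by (auto simp: birkhoff_sum_def intro!: exI[of _ 0] near_mod_refl Z.near_mod_refl)

lemma returns_add:
  assumes "s \<in> returns v" "t \<in> returns v"
  shows "s + t \<in> returns v"
  unfolding returns_def
proof (intro CollectI allI impI)
  fix e :: real assume "e > 0"
  then have "e/2 > 0" by simp
  obtain k where k: "near_mod L (e/2) ((F ^^ k) v) v" "near_mod \<int> (e/2) (G k v) s"
    using assms(1) \<open>e/2 > 0\<close> unfolding returns_def by blast
  obtain n where n: "near_mod L (e/2) ((F ^^ (k + n)) v) ((F ^^ k) v)"
    "near_mod \<int> (e/2) (G (k + n) v) (G k v + t)"
    using returns_shift[OF assms(2) \<open>e/2 > 0\<close>] by metis
  have "near_mod \<int> (e/2) (G k v + t) (s + t)"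
    using k(2) by (simp add: near_mod_def)
  then show "\<exists>k. near_mod L e ((F ^^ k) v) v \<and> near_mod \<int> e (G k v) (s + t)"
    using near_mod_trans[OF n(1) k(1), of e] Z.near_mod_trans[OF n(2), of "e/2" "s + t" e]
    by (intro exI[of _ "k + n"]) simp
qed

lemma returns_mult: "t \<in> returns v \<Longrightarrow> real n * t \<in> returns v"
  by (induction n) (auto simp: returns_zero algebra_simps intro: returns_add)

text \<open>By Dirichlet's theorem some positive multiple \<open>k * t\<close> is close to an
  integer, so \<open>(k - 1) * t\<close> is close to \<open>- t\<close> modulo 1. A closed
  subsemigroup of the circle is therefore a group.\<close>

lemma returns_minus:
  assumes "t \<in> returns v"
  shows "- t \<in> returns v"
proof (rule returns_approx)
  fix e :: real assume "e > 0"
  then obtain N :: nat where N: "1 / N < e" "N > 0"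
    by (metis gr_zeroI inverse_eq_divide real_arch_inverse)
  obtain h k where hk: "0 < k" "\<bar>of_int k * t - of_int h\<bar> < 1 / N"
    using Dirichlet_approx[OF N(2)] by metis
  have "real (nat (k - 1)) * t \<in> returns v"
    using assms by (rule returns_mult)
  moreover have "near_mod \<int> e (real (nat (k - 1)) * t) (- t)"
    unfolding near_mod_def using hk N by (intro bexI[of _ "of_int h"]) (auto simp: algebra_simps)
  ultimately show "\<exists>s\<in>returns v. near_mod \<int> e s (- t)"
    by blast
qed

text \<open>Only a relation between the three displacements is obtained here. Their limits are
  extracted by compactness in \<open>all_returns\<close>.\<close>

lemma shear_returns:
  assumes "e > 0"
  shows "\<exists>n k. near_mod L e ((F ^^ n) v) v \<and> near_mod L e ((F ^^ k) v) v \<and>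
    near_mod L e ((F ^^ (n + k)) v) v \<and> near_mod \<int> e (G (n + k) v) (G n v + G k v + t)"
proof -
  have e3: "e / 3 > 0" using assms by simp
  \<comment> \<open>With this bound the whole shift \<open>t *\<^sub>R u\<close> is shorter than
    \<open>e / 3\<close>; adding 1 covers the case \<open>t = 0\<close>.\<close>
  define e' where "e' = e / 3 / (\<bar>t\<bar> + 1)"
  have e': "e' > 0" using e3 by (simp add: e'_def)
  obtain J where J: "\<And>n. n \<ge> J \<Longrightarrow> \<exists>u. norm u < e' \<and>
      (\<forall>v t. (F ^^ n) (v + t *\<^sub>R u) = (F ^^ n) v + t *\<^sub>R u \<and>
        G n (v + t *\<^sub>R u) = G n v + t)"
    using shear[OF e'] by blast
  obtain n where n: "n \<ge> J" "near_mod L (e/3) ((F ^^ n) v) v"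
    using recurrence[OF e3] by metis
  obtain u where u: "norm u < e'"
    "(F ^^ n) (v + t *\<^sub>R u) = (F ^^ n) v + t *\<^sub>R u" "G n (v + t *\<^sub>R u) = G n v + t"
    using J[OF n(1)] by blast
  have tu: "norm (t *\<^sub>R u) < e/3"
  proof -
    have "\<bar>t\<bar> * norm u \<le> \<bar>t\<bar> * e'" using u(1) by (simp add: mult_left_mono)
    also have "\<dots> < (\<bar>t\<bar> + 1) * e'" using e' by simp
    also have "\<dots> = e/3"
      using nonzero_mult_div_cancel_left[of "\<bar>t\<bar> + 1" "e/3"] add_nonneg_pos[of "\<bar>t\<bar>" 1]
      unfolding e'_def times_divide_eq_right by simp
    finally show ?thesis by simp
  qed
  then have tu': "near_mod L (e/3) (t *\<^sub>R u + w) w" for w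
    by (intro near_mod_norm) simp
  obtain d where d: "d > 0" "\<And>w. near_mod L d w (v + t *\<^sub>R u) \<Longrightarrow>
      near_mod L (e/3) ((F ^^ n) w) ((F ^^ n) (v + t *\<^sub>R u))"
    using cont_modE[OF cont_mod_funpow[OF cont_base] e3] by metis
  obtain d' where d': "d' > 0" "\<And>w. near_mod L d' w (v + t *\<^sub>R u) \<Longrightarrow>
      near_mod \<int> e (G n w) (G n (v + t *\<^sub>R u))"
    using cont_modE[OF cont_mod_birkhoff_sum[OF cont_base cont_fibre] assms] by metis
  \<comment> \<open>Time \<open>k\<close> will bring \<open>v\<close> within \<open>c\<close> of
    \<open>v + t *\<^sub>R u\<close>. This is close enough for the next \<open>n\<close> steps to
    follow those of \<open>v + t *\<^sub>R u\<close>, whose displacement is \<open>G n v + t\<close>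
    by the shear.\<close>
  define c where "c = min (min d d') (e/3)"
  have "c > 0" using d d' assms by (simp add: c_def)
  then obtain k where k: "near_mod L c ((F ^^ k) v) (v + t *\<^sub>R u)"
    using base_minimal unfolding minimal_mod_def by blast
  have kd: "near_mod L d ((F ^^ k) v) (v + t *\<^sub>R u)" "near_mod L d' ((F ^^ k) v) (v + t *\<^sub>R u)"
    "near_mod L (e/3) ((F ^^ k) v) (v + t *\<^sub>R u)"
    using near_mod_mono[OF k] by (auto simp: c_def)
  have a: "near_mod L (e/3 + e/3) ((F ^^ k) v) v"
    using near_mod_trans[OF kd(3), of "e/3" v] tu'[of v] by (simp add: add.commute)
  have "near_mod L (e/3) ((F ^^ n) ((F ^^ k) v)) (t *\<^sub>R u + (F ^^ n) v)"
    using d(2)[OF kd(1)] u(2) by (simp add: add.commute)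
  then have "near_mod L (e/3 + e/3) ((F ^^ (n + k)) v) ((F ^^ n) v)"
    using near_mod_trans[OF _ tu'] by (auto simp: funpow_add)
  then have b: "near_mod L e ((F ^^ (n + k)) v) v"
    using near_mod_trans[OF _ n(2)] by auto
  have "near_mod \<int> e (G n ((F ^^ k) v)) (G n v + t)"
    using d'(2)[OF kd(2)] u(3) by simp
  moreover have "G (n + k) v - (G n v + G k v + t) = G n ((F ^^ k) v) - (G n v + t)"
    by (simp add: birkhoff_sum_add)
  ultimately have "near_mod \<int> e (G (n + k) v) (G n v + G k v + t)"
    by (simp only: near_mod_def)
  then show ?thesis
    using b near_mod_mono[OF a, of e] near_mod_mono[OF n(2), of e] assms by auto
qed

text \<open>The displacements themselves may be unbounded, so the limit is taken along
  representatives \<open>f i\<close> modulo 1.\<close>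

lemma limit_returns:
  assumes "\<And>i. near_mod L (1 / real (Suc i)) ((F ^^ n i) v) v"
    and "\<And>i. near_mod \<int> (1 / real (Suc i)) (G (n i) v) (f i)"
    and "strict_mono r" "(\<lambda>i. f (r i)) \<longlonglongrightarrow> s"
  shows "s \<in> returns v"
  unfolding returns_def
proof (intro CollectI allI impI)
  fix e :: real assume "e > 0"
  have "eventually (\<lambda>i. \<bar>f (r i) - s\<bar> < e/2) sequentially"
    using tendstoD[OF assms(4), of "e/2"] \<open>e > 0\<close> by (simp add: dist_real_def)
  moreover have "eventually (\<lambda>i. 1 / real (Suc i) < e/2) sequentially"
    using order_tendstoD(2)[OF LIMSEQ_inverse_real_of_nat, of "e/2"] \<open>e > 0\<close>
    by (simp add: inverse_eq_divide)
  ultimately obtain i where i: "\<bar>f (r i) - s\<bar> < e/2" "1 / real (Suc i) < e/2"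
    by (metis (no_types, lifting) eventually_conj eventually_happens' sequentially_bot)
  have "i \<le> r i" using assms(3) by (rule seq_suble)
  then have "1 / real (Suc (r i)) \<le> 1 / real (Suc i)"
    by (simp add: frac_le)
  then have le: "1 / real (Suc (r i)) \<le> e/2" using i by linarith
  have "near_mod \<int> (e/2) (f (r i)) s"
    using i(1) by (intro Z.near_mod_norm) simp
  then have "near_mod \<int> e (G (n (r i)) v) s"
    using Z.near_mod_trans[OF assms(2)[of "r i"], of "e/2" s e] le by simp
  moreover have "near_mod L e ((F ^^ n (r i)) v) v"
    using near_mod_mono[OF assms(1)[of "r i"]] le \<open>e > 0\<close> by auto
  ultimately show "\<exists>k. near_mod L e ((F ^^ k) v) v \<and> near_mod \<int> e (G k v) s"
    by blast
qed

lemma near_mod_frac: "e > 0 \<Longrightarrow> near_mod \<int> e x (frac x)"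
  unfolding near_mod_def by (intro bexI[of _ "of_int \<lfloor>x\<rfloor>"]) (auto simp: frac_def)

text \<open>Fractional parts place the displacements at the times \<open>n i\<close> and
  \<open>k i\<close> in a compact square. Along a common subsequence they converge to some s and s',
  and the displacements at \<open>n i + k i\<close> converge to s + s' + t modulo 1. All three
  limits are returns, and returns form a group, so \<open>t\<close> is a return.\<close>

lemma all_returns: "t \<in> returns v"
proof -
  have "\<forall>i. \<exists>n k. near_mod L (1 / real (Suc i)) ((F ^^ n) v) v \<and>
      near_mod L (1 / real (Suc i)) ((F ^^ k) v) v \<and>
      near_mod L (1 / real (Suc i)) ((F ^^ (n + k)) v) v \<and>
      near_mod \<int> (1 / real (Suc i)) (G (n + k) v) (G n v + G k v + t)"
    by (intro allI shear_returns) simp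
  then obtain n k where nk: "\<And>i. near_mod L (1 / real (Suc i)) ((F ^^ n i) v) v"
      "\<And>i. near_mod L (1 / real (Suc i)) ((F ^^ k i) v) v"
      "\<And>i. near_mod L (1 / real (Suc i)) ((F ^^ (n i + k i)) v) v"
      "\<And>i. near_mod \<int> (1 / real (Suc i)) (G (n i + k i) v) (G (n i) v + G (k i) v + t)"
    by metis
  have "compact ({0..1::real} \<times> {0..1::real})"
    by (intro compact_Times) auto
  then have "seq_compact ({0..1::real} \<times> {0..1::real})"
    by (rule compact_imp_seq_compact)
  moreover have "\<forall>i. (frac (G (n i) v), frac (G (k i) v)) \<in> {0..1::real} \<times> {0..1::real}"
    by (auto intro: less_imp_le[OF frac_lt_1])
  ultimately obtain l r where r: "strict_mono (r :: nat \<Rightarrow> nat)"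
    "((\<lambda>i. (frac (G (n i) v), frac (G (k i) v))) \<circ> r) \<longlonglongrightarrow> l"
    by (rule seq_compactE)
  have l1: "(\<lambda>i. frac (G (n (r i)) v)) \<longlonglongrightarrow> fst l" and l2: "(\<lambda>i. frac (G (k (r i)) v)) \<longlonglongrightarrow> snd l"
    using tendsto_fst[OF r(2)] tendsto_snd[OF r(2)] by (simp_all add: o_def)
  have "fst l \<in> returns v"
    by (rule limit_returns[OF nk(1) near_mod_frac r(1) l1]) simp
  moreover have "snd l \<in> returns v"
    by (rule limit_returns[OF nk(2) near_mod_frac r(1) l2]) simp
  moreover have "fst l + snd l + t \<in> returns v"
  proof (rule limit_returns[OF nk(3) _ r(1), where f="\<lambda>i. frac (G (n i) v) + frac (G (k i) v) + t"])
    show "(\<lambda>i. frac (G (n (r i)) v) + frac (G (k (r i)) v) + t) \<longlonglongrightarrow> fst l + snd l + t"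
      by (intro tendsto_add l1 l2 tendsto_const)
    fix i
    have "(frac (G (n i) v) + frac (G (k i) v) + t) = (G (n i) v + G (k i) v + t)
        - of_int (\<lfloor>G (n i) v\<rfloor> + \<lfloor>G (k i) v\<rfloor>)"
      by (simp add: frac_def)
    moreover have "near_mod \<int> (1 / real (Suc i)) x (y - of_int m)"
      if "near_mod \<int> (1 / real (Suc i)) x y" for x y :: real and m
    proof -
      obtain d where "d \<in> \<int>" "norm (x - y - d) < 1 / real (Suc i)"
        using \<open>near_mod \<int> (1 / real (Suc i)) x y\<close> unfolding near_mod_def by blast
      then show ?thesis
        unfolding near_mod_def by (intro bexI[of _ "d + of_int m"]) (auto simp: algebra_simps)
    qed
    ultimately show "near_mod \<int> (1 / real (Suc i)) (G (n i + k i) v)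
        (frac (G (n i) v) + frac (G (k i) v) + t)"
      using nk(4) by metis
  qed
  ultimately have "(fst l + snd l + t) + (- (fst l) + - (snd l)) \<in> returns v"
    by (metis returns_add returns_minus)
  then show ?thesis by simp
qed

text \<open>Time \<open>k\<close> brings the base point close to its target. The remaining fibre
  error \<open>y - z - G k v\<close> is a return displacement, as every real number is, so one more
  near-return corrects it without spoiling the base.\<close>

theorem skew_minimal: "minimal_mod (L \<times> \<int>) (skew F g)"
  unfolding minimal_mod_def
proof (intro allI impI)
  fix p q :: "'v \<times> real" and e :: real assume "e > 0"
  then have e2: "e/4 > 0" by simp
  obtain v z w y where pq: "p = (v, z)" "q = (w, y)" by fastforce
  obtain k where k: "near_mod L (e/4) ((F ^^ k) v) w"
    using base_minimal e2 unfolding minimal_mod_def by blast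
  obtain n where n: "near_mod L (e/4) ((F ^^ (k + n)) v) ((F ^^ k) v)"
    "near_mod \<int> (e/4) (G (k + n) v) (G k v + (y - z - G k v))"
    using returns_shift[OF all_returns e2] by metis
  have "near_mod L (e/2) ((F ^^ (k + n)) v) w"
    using near_mod_trans[OF n(1) k] by simp
  then obtain d where d: "d \<in> L" "norm ((F ^^ (k + n)) v - w - d) < e/2"
    unfolding near_mod_def by blast
  obtain m where m: "m \<in> \<int>" "norm (z + G (k + n) v - y - m) < e/4"
    using n(2) unfolding near_mod_def by (auto simp: algebra_simps)
  have "norm ((skew F g ^^ (k + n)) p - q - (d, m)) < e"
    using norm_Pair_le[of "(F ^^ (k + n)) v - w - d" "z + G (k + n) v - y - m"] d(2) m(2) \<open>e > 0\<close>
    by (simp add: pq skew_funpow)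
  then show "\<exists>k. near_mod (L \<times> \<int>) e ((skew F g ^^ k) p) q"
    unfolding near_mod_def using d(1) m(1) by blast
qed

end

section \<open>Rotations and skew products on tori\<close>

text \<open>Linear independence over the rationals of 1 together with the numbers
  \<open>\<theta> i\<close>, \<open>i < n\<close>: the integer value of the sum plays the part of
  the coefficient of 1.\<close>

definition indep_mod1 :: "nat \<Rightarrow> (nat \<Rightarrow> real) \<Rightarrow> bool" where
  "indep_mod1 n \<theta> \<longleftrightarrow>
    (\<forall>c :: nat \<Rightarrow> int. (\<Sum>i<n. of_int (c i) * \<theta> i) \<in> \<int> \<longrightarrow> (\<forall>i<n. c i = 0))"

lemma Kronecker_int:
  assumes "indep_mod1 n \<theta>" "e > 0"
  obtains k :: int and m where "\<And>i. i < n \<Longrightarrow> \<bar>of_int k * \<theta> i - of_int (m i) - \<alpha> i\<bar> < e"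
proof -
  interpret Modules.module "(\<lambda>r x. real_of_int r * x)"
    by (simp add: Modules.module.intro distrib_left mult.commute)
  define \<theta>' where "\<theta>' = \<theta>(n := 1)"
  have zero: "c i = 0" if "(\<Sum>i\<le>n. of_int (c i) * \<theta>' i) = 0" "i \<le> n" for c i
  proof -
    have eq: "(\<Sum>i<n. of_int (c i) * \<theta> i) + of_int (c n) = 0"
      using that(1) by (simp add: \<theta>'_def lessThan_Suc_atMost[symmetric])
    then have "(\<Sum>i<n. of_int (c i) * \<theta> i) = of_int (- c n)"
      by simp
    then have z: "\<forall>i<n. c i = 0"
      using assms(1) unfolding indep_mod1_def by (metis Ints_of_int)
    with eq have "c n = 0" by simp
    with z show ?thesis
      using \<open>i \<le> n\<close> by (cases "i = n") auto
  qed
  have inj: "inj_on \<theta>' {..n}"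
  proof (rule inj_onI, rule ccontr)
    fix i j assume ij: "i \<in> {..n}" "j \<in> {..n}" "\<theta>' i = \<theta>' j" "i \<noteq> j"
    \<comment> \<open>The difference of the indicators of \<open>i\<close> and \<open>j\<close>
      turns a coincidence of two values into a nontrivial relation.\<close>
    define c :: "nat \<Rightarrow> int" where "c l = (if l = i then 1 else 0) - (if l = j then 1 else 0)" for l
    have "(\<Sum>l\<le>n. of_int (c l) * \<theta>' l)
      = (\<Sum>l\<le>n. (if l = i then \<theta>' l else 0)) - (\<Sum>l\<le>n. (if l = j then \<theta>' l else 0))"
      unfolding sum_subtractf[symmetric] by (rule sum.cong) (auto simp: c_def)
    also have "\<dots> = 0"
      using ij by simp
    finally show False
      using zero[of c i] ij by (simp add: c_def)
  qed
  have "independent (\<theta>' ` {..n})"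
  proof
    assume "dependent (\<theta>' ` {..n})"
    then obtain u where u: "\<exists>v\<in>\<theta>' ` {..n}. u v \<noteq> 0" "(\<Sum>v\<in>\<theta>' ` {..n}. of_int (u v) * v) = 0"
      by (auto simp: dependent_finite)
    have "(\<Sum>i\<le>n. of_int (u (\<theta>' i)) * \<theta>' i) = 0"
      using u(2) by (simp add: sum.reindex[OF inj])
    then show False
      using zero[of "\<lambda>i. u (\<theta>' i)"] u(1) by auto
  qed
  moreover have "\<theta>' n = 1"
    by (simp add: \<theta>'_def)
  ultimately obtain k m where "\<And>i. i < n \<Longrightarrow> \<bar>of_int k * \<theta>' i - of_int (m i) - \<alpha> i\<bar> < e"
    using Kronecker_thm_2[OF _ inj _ assms(2), of \<alpha>] by metis
  then show ?thesis
    using that[of k m] by (simp add: \<theta>'_def)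
qed

text \<open>A negative time \<open>k\<close> is made positive by adding \<open>\<bar>k\<bar>\<close> times a positive near-return time.\<close>

lemma Kronecker_nat:
  assumes "indep_mod1 n \<theta>" "e > 0"
  obtains k :: nat where "\<And>i. i < n \<Longrightarrow> near_mod \<int> e (real k * \<theta> i) (\<alpha> i)"
proof -
  have "e / 2 > 0" using assms by simp
  obtain k :: int and m where km: "\<And>i. i < n \<Longrightarrow> \<bar>of_int k * \<theta> i - of_int (m i) - \<alpha> i\<bar> < e/2"
    using Kronecker_int[OF assms(1) \<open>e / 2 > 0\<close>] by metis
  \<comment> \<open>Repeating a return of error 1/N altogether \<open>\<bar>k\<bar>\<close> times
    then costs at most \<open>e / 2\<close>.\<close>
  obtain N :: nat where N: "of_int \<bar>k\<bar> * 2 / e < real N"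
    using reals_Archimedean2 by blast
  have "0 \<le> of_int \<bar>k\<bar> * 2 / e"
    using assms(2) by simp
  with N have "N > 0"
    by (metis of_nat_0_less_iff order_le_less_trans)
  obtain q p where q: "0 < q" "\<And>i. i < n \<Longrightarrow> \<bar>of_int q * \<theta> i - of_int (p i)\<bar> < 1/N"
    using Dirichlet_approx_simult[OF \<open>N > 0\<close>] by metis
  \<comment> \<open>This is nonnegative because \<open>q\<close> is at least 1.\<close>
  define k' where "k' = nat (k + \<bar>k\<bar> * q)"
  have "\<bar>k\<bar> * 1 \<le> \<bar>k\<bar> * q"
    using q(1) by (intro mult_left_mono) auto
  then have k': "int k' = k + \<bar>k\<bar> * q"
    by (simp add: k'_def)
  then have k'': "real k' = of_int k + of_int \<bar>k\<bar> * of_int q"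
    by (metis of_int_add of_int_mult of_int_of_nat_eq)
  have "near_mod \<int> e (real k' * \<theta> i) (\<alpha> i)" if "i < n" for i
  proof -
    have "of_int \<bar>k\<bar> * \<bar>of_int q * \<theta> i - of_int (p i)\<bar> \<le> of_int \<bar>k\<bar> * (1/N)"
      using q(2)[OF that] by (intro mult_left_mono) auto
    also have "\<dots> \<le> e/2"
      using N assms(2) \<open>N > 0\<close> by (simp add: field_simps)
    finally have "\<bar>of_int \<bar>k\<bar> * (of_int q * \<theta> i - of_int (p i))\<bar> \<le> e/2"
      by (simp add: abs_mult)
    moreover have "real k' * \<theta> i - \<alpha> i - of_int (m i + \<bar>k\<bar> * p i)
        = (of_int k * \<theta> i - of_int (m i) - \<alpha> i) + of_int \<bar>k\<bar> * (of_int q * \<theta> i - of_int (p i))"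
      unfolding k'' by (simp add: algebra_simps)
    ultimately have "\<bar>real k' * \<theta> i - \<alpha> i - of_int (m i + \<bar>k\<bar> * p i)\<bar> < e"
      using km[OF that] by linarith
    then show ?thesis
      unfolding near_mod_def real_norm_def by (metis Ints_of_int)
  qed
  then show ?thesis using that by blast
qed

section \<open>Minimal rotations in dimensions one to three\<close>

lemma translation_funpow:
  fixes t :: "'a::real_vector"
  shows "((\<lambda>v. v + t) ^^ k) v = v + real k *\<^sub>R t"
  by (induction k) (simp_all add: algebra_simps)

lemma near_mod_Times:
  assumes "near_mod L e x x'" "near_mod M e' y y'" "e + e' \<le> e''"
  shows "near_mod (L \<times> M) e'' (x, y) (x', y')"
proof -
  obtain d d' where d: "d \<in> L" "norm (x - x' - d) < e" "d' \<in> M" "norm (y - y' - d') < e'"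
    using assms(1,2) unfolding near_mod_def by blast
  have "norm ((x, y) - (x', y') - (d, d')) < e''"
    using norm_Pair_le[of "x - x' - d" "y - y' - d'"] d assms(3) by simp
  then show ?thesis
    using d unfolding near_mod_def by blast
qed

lemma near_mod_diff: "near_mod L e (v + x) w \<longleftrightarrow> near_mod L e x (w - v)"
  unfolding near_mod_def by (simp add: algebra_simps)

lemma minimal_translation1:
  fixes a :: real
  assumes "\<And>x :: int. of_int x * a \<in> \<int> \<Longrightarrow> x = 0"
  shows "minimal_mod \<int> (\<lambda>v. v + a)"
  unfolding minimal_mod_def
proof (intro allI impI)
  fix v w e :: real assume "e > 0"
  have "indep_mod1 1 (\<lambda>i. a)"
    using assms by (auto simp: indep_mod1_def)
  then obtain k where k: "\<And>i :: nat. i < 1 \<Longrightarrow> near_mod \<int> e (real k * a) (w - v)"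
    by (rule Kronecker_nat[OF _ \<open>e > 0\<close>, where \<alpha>="\<lambda>i. w - v"]) blast
  then show "\<exists>k. near_mod \<int> e (((\<lambda>v. v + a) ^^ k) v) w"
    using k[of 0] unfolding translation_funpow near_mod_diff by (intro exI[of _ k]) simp
qed

lemma minimal_translation2:
  fixes a b :: real
  assumes "\<And>x y :: int. of_int x * a + of_int y * b \<in> \<int> \<Longrightarrow> x = 0 \<and> y = 0"
  shows "minimal_mod (\<int> \<times> \<int>) (\<lambda>v. v + (a, b))"
  unfolding minimal_mod_def
proof (intro allI impI)
  fix v w :: "real \<times> real" and e :: real assume "e > 0"
  then have "e / 2 > 0" by simp
  define \<theta> where "\<theta> = (\<lambda>i :: nat. if i = 0 then a else b)"
  define \<alpha> where "\<alpha> = (\<lambda>i :: nat. if i = 0 then fst (w - v) else snd (w - v))"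
  have "indep_mod1 2 \<theta>"
    using assms unfolding indep_mod1_def
    by (auto simp: \<theta>_def numeral_2_eq_2 less_Suc_eq)
  then obtain k where "\<And>i. i < 2 \<Longrightarrow> near_mod \<int> (e/2) (real k * \<theta> i) (\<alpha> i)"
    using Kronecker_nat[OF _ \<open>e / 2 > 0\<close>] by metis
  from this[of 0] this[of 1]
  have "near_mod (\<int> \<times> \<int>) e (real k * a, real k * b) (fst (w - v), snd (w - v))"
    by (intro near_mod_Times[of _ "e/2" _ _ _ "e/2"]) (auto simp: \<theta>_def \<alpha>_def)
  then show "\<exists>k. near_mod (\<int> \<times> \<int>) e (((\<lambda>v. v + (a, b)) ^^ k) v) w"
    unfolding translation_funpow near_mod_diff by (intro exI[of _ k]) (cases v, cases w, simp)
qed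

lemma minimal_translation3:
  fixes a b c :: real
  assumes "\<And>x y z :: int. of_int x * a + of_int y * b + of_int z * c \<in> \<int> \<Longrightarrow> x = 0 \<and> y = 0 \<and> z = 0"
  shows "minimal_mod ((\<int> \<times> \<int>) \<times> \<int>) (\<lambda>v. v + ((a, b), c))"
  unfolding minimal_mod_def
proof (intro allI impI)
  fix v w :: "(real \<times> real) \<times> real" and e :: real assume "e > 0"
  then have "e / 4 > 0" by simp
  define \<theta> where "\<theta> = (\<lambda>i :: nat. if i = 0 then a else if i = 1 then b else c)"
  define \<alpha> where "\<alpha> = (\<lambda>i :: nat. if i = 0 then fst (fst (w - v)) else
    if i = 1 then snd (fst (w - v)) else snd (w - v))"
  have "indep_mod1 3 \<theta>"
    using assms unfolding indep_mod1_def
    by (auto simp: \<theta>_def numeral_3_eq_3 less_Suc_eq)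
  then obtain k where "\<And>i. i < 3 \<Longrightarrow> near_mod \<int> (e/4) (real k * \<theta> i) (\<alpha> i)"
    using Kronecker_nat[OF _ \<open>e / 4 > 0\<close>] by metis
  from this[of 0] this[of 1] this[of 2]
  have "near_mod ((\<int> \<times> \<int>) \<times> \<int>) e ((real k * a, real k * b), real k * c)
    ((fst (fst (w - v)), snd (fst (w - v))), snd (w - v))"
    using \<open>e > 0\<close>
    by (intro near_mod_Times[of _ "e/2" _ _ _ "e/4"] near_mod_Times[of _ "e/4" _ _ _ "e/4"])
      (auto simp: \<theta>_def \<alpha>_def)
  then show "\<exists>k. near_mod ((\<int> \<times> \<int>) \<times> \<int>) e (((\<lambda>v. v + ((a, b), c)) ^^ k) v) w"
    unfolding translation_funpow near_mod_diff
    by (intro exI[of _ k]) (cases v, cases w, cases "fst v", cases "fst w", simp)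
qed

section \<open>Minimal unipotent affine maps in dimensions two and three\<close>

interpretation Z2: add_subgroup "\<int> \<times> \<int> :: (real \<times> real) set"
  by unfold_locales (auto simp: zero_prod_def)

definition skew2 :: "real \<Rightarrow> int \<Rightarrow> real \<Rightarrow> real \<times> real \<Rightarrow> real \<times> real" where
  "skew2 a m b = (\<lambda>(x, y). (x + a, of_int m * x + y + b))"

lemma skew2_eq: "skew2 a m b = skew (\<lambda>x. x + a) (\<lambda>x. of_int m * x + b)"
  by (auto simp: skew2_def skew_def)

lemma cont_mod_translation: "cont_mod \<int> \<int> (\<lambda>x :: real. x + a)"
  by (rule cont_modI) (auto intro!: continuous_intros)

text \<open>This bounds the length of the shear vectors. A nonzero integer has absolute value at
  least 1, so any \<open>J\<close> above \<open>1 / e\<close> works.\<close>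

lemma large_multiple:
  fixes e :: real and m :: int
  assumes "e > 0" "m \<noteq> 0"
  shows "\<exists>J. \<forall>n\<ge>J. \<bar>1 / (real n * of_int m)\<bar> < e \<and> n > 0"
proof -
  obtain J :: nat where J: "1 / e < real J"
    using reals_Archimedean2 by blast
  have "\<bar>1 / (real n * of_int m)\<bar> < e \<and> n > 0" if "n \<ge> J" for n
  proof -
    have n: "1 / e < real n" using J that by linarith
    moreover have "1 / e > 0" using assms by simp
    ultimately have "n > 0" by (metis of_nat_0_less_iff order_less_trans)
    have "1 \<le> \<bar>real_of_int m\<bar>" using assms(2) by linarith
    then have "real n * 1 \<le> real n * \<bar>of_int m\<bar>" by (intro mult_left_mono) auto
    then have "1 / e < real n * \<bar>of_int m\<bar>" using n by linarith
    then show ?thesis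
      using \<open>n > 0\<close> assms by (simp add: abs_mult field_simps)
  qed
  then show ?thesis by blast
qed

text \<open>The \<open>n\<close>-step displacement has slope \<open>n * m\<close> in the base
  variable, so \<open>1 / (n * m)\<close> is a shear vector over the irrational rotation.\<close>

lemma minimal_skew2:
  assumes "\<And>x :: int. of_int x * a \<in> \<int> \<Longrightarrow> x = 0" "m \<noteq> 0"
  shows "minimal_mod (\<int> \<times> \<int>) (skew2 a m b)"
proof -
  interpret skew_product "\<int>" "\<lambda>x. x + a" "\<lambda>x. of_int m * x + b"
  proof
    show "minimal_mod \<int> (\<lambda>x. x + a)"
      by (rule minimal_translation1) (rule assms)
    show "cont_mod \<int> \<int> (\<lambda>x. x + a)"
      by (rule cont_mod_translation)
    show "cont_mod \<int> \<int> (\<lambda>x. of_int m * x + b)"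
      by (rule cont_modI) (auto intro!: continuous_intros simp: algebra_simps)
    fix e :: real assume "e > 0"
    then obtain J where J: "\<forall>n\<ge>J. \<bar>1 / (real n * of_int m)\<bar> < e \<and> n > 0"
      using large_multiple[OF _ assms(2)] by blast
    have "birkhoff_sum (\<lambda>x. x + a) (\<lambda>x. of_int m * x + b) n (v + s)
        = birkhoff_sum (\<lambda>x. x + a) (\<lambda>x. of_int m * x + b) n v + real n * of_int m * s" for n v s
      by (simp add: birkhoff_sum_def translation_funpow algebra_simps sum.distrib)
    then show "\<exists>J. \<forall>n\<ge>J. \<exists>u. norm u < e \<and>
      (\<forall>v t. ((\<lambda>x. x + a) ^^ n) (v + t *\<^sub>R u) = ((\<lambda>x. x + a) ^^ n) v + t *\<^sub>R u \<and>
        birkhoff_sum (\<lambda>x. x + a) (\<lambda>x. of_int m * x + b) n (v + t *\<^sub>R u)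
          = birkhoff_sum (\<lambda>x. x + a) (\<lambda>x. of_int m * x + b) n v + t)"
      using J assms(2)
      by (intro exI[of _ J] allI impI exI[of _ "1 / (real _ * of_int m)"])
        (auto simp: translation_funpow)
  qed
  show ?thesis
    unfolding skew2_eq by (rule skew_minimal)
qed

text \<open>The coordinates are nested as \<open>((x, y), z)\<close> so that the map is a skew
  product over \<open>skew2\<close>.\<close>

definition skew3 :: "real \<Rightarrow> int \<Rightarrow> real \<Rightarrow> int \<Rightarrow> int \<Rightarrow> real
    \<Rightarrow> (real \<times> real) \<times> real \<Rightarrow> (real \<times> real) \<times> real" where
  "skew3 a m b w n c =
    (\<lambda>((x, y), z). ((x + a, of_int m * x + y + b), of_int w * x + of_int n * y + z + c))"

lemma skew3_eq:
  "skew3 a m b w n c = skew (skew2 a m b) (\<lambda>(x, y). of_int w * x + of_int n * y + c)"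
  by (auto simp: skew3_def skew2_def skew_def)

lemma skew2_funpow_shift:
  assumes "m = 0 \<or> s = 0"
  shows "(skew2 a m b ^^ k) ((x, y) + (s, t)) = (skew2 a m b ^^ k) (x, y) + (s, t)"
proof (induction k)
  case (Suc k)
  have "skew2 a m b (v + (s, t)) = skew2 a m b v + (s, t)" for v
    using assms by (cases v) (auto simp: skew2_def)
  then show ?case using Suc by simp
qed simp

text \<open>The shear direction must be fixed by the linear part of the base and must change the
  fibre function. If \<open>n\<close> is nonzero the \<open>y\<close> direction serves; otherwise
  \<open>m = 0\<close>, so the base is a translation, and the \<open>x\<close> direction serves
  because \<open>w\<close> is nonzero.\<close>

lemma minimal_skew3:
  assumes "minimal_mod (\<int> \<times> \<int>) (skew2 a m b)" and "n \<noteq> 0 \<or> m = 0 \<and> w \<noteq> 0"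
  shows "minimal_mod ((\<int> \<times> \<int>) \<times> \<int>) (skew3 a m b w n c)"
proof -
  define g where "g = (\<lambda>(x, y). real_of_int w * x + of_int n * y + c)"
  interpret skew_product "\<int> \<times> \<int>" "skew2 a m b" g
  proof
    show "minimal_mod (\<int> \<times> \<int>) (skew2 a m b)"
      by fact
    show "cont_mod (\<int> \<times> \<int>) (\<int> \<times> \<int>) (skew2 a m b)"
      unfolding skew2_def case_prod_unfold
      by (rule cont_modI) (auto intro!: continuous_intros simp: algebra_simps)
    show "cont_mod (\<int> \<times> \<int>) \<int> g"
      unfolding g_def case_prod_unfold
      by (rule cont_modI) (auto intro!: continuous_intros simp: algebra_simps)
    fix e :: real assume "e > 0"
    define p where "p = (if n = 0 then w else n)"
    have "p \<noteq> 0" using assms(2) by (auto simp: p_def)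
    then obtain J where J: "\<forall>k\<ge>J. \<bar>1 / (real k * of_int p)\<bar> < e \<and> k > 0"
      using large_multiple[OF \<open>e > 0\<close>] by blast
    define u where "u k =
      (if n = 0 then (1 / (real k * of_int p), 0) else (0, 1 / (real k * of_int p)))" for k
    have F: "(skew2 a m b ^^ k) (v + t *\<^sub>R u i) = (skew2 a m b ^^ k) v + t *\<^sub>R u i" for k v t i
      using skew2_funpow_shift[of m "fst (t *\<^sub>R u i)" k a b "fst v" "snd v" "snd (t *\<^sub>R u i)"] assms(2)
      by (auto simp: u_def)
    \<comment> \<open>Each of the \<open>k\<close> steps contributes an equal share of the total
      displacement \<open>t\<close>.\<close>
    have g: "g (v + t *\<^sub>R u k) = g v + t / real k" for v t k
      using \<open>p \<noteq> 0\<close> by (cases v) (auto simp: g_def u_def p_def field_simps)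
    have "birkhoff_sum (skew2 a m b) g k (v + t *\<^sub>R u k) = birkhoff_sum (skew2 a m b) g k v + t"
      if "k > 0" for k v t
      using that by (simp add: birkhoff_sum_def F g sum.distrib)
    moreover have "norm (u k) = \<bar>1 / (real k * of_int p)\<bar>" for k
      by (simp add: u_def)
    ultimately show "\<exists>J. \<forall>k\<ge>J. \<exists>u. norm u < e \<and>
      (\<forall>v t. (skew2 a m b ^^ k) (v + t *\<^sub>R u) = (skew2 a m b ^^ k) v + t *\<^sub>R u \<and>
        birkhoff_sum (skew2 a m b) g k (v + t *\<^sub>R u) = birkhoff_sum (skew2 a m b) g k v + t)"
      using J F by metis
  qed
  show ?thesis
    using skew_minimal unfolding skew3_eq g_def by simp
qed

section \<open>Affine actions on the torus\<close>

definition unip :: "int \<Rightarrow> int \<Rightarrow> int \<Rightarrow> int ^ 3 ^ 3" where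
  "unip m w n = vector [vector [1, 0, 0], vector [m, 1, 0], vector [w, n, 1]]"

text \<open>This is the multiplication of the integral Heisenberg group. The cross term is what
  keeps \<omega> from being additive in general.\<close>

lemma unip_mult: "unip m w n ** unip m' w' n' = unip (m + m') (w + w' + n * m') (n + n')"
  by (simp add: unip_def matrix_matrix_mult_def vec_eq_iff forall_3 sum_3)

lemma unip_0: "unip 0 0 0 = mat 1"
  by (simp add: unip_def mat_def vec_eq_iff forall_3)

lemma unip_inject: "unip m w n = unip m' w' n' \<longleftrightarrow> m = m' \<and> w = w' \<and> n = n'"
  by (auto simp: unip_def vec_eq_iff forall_3)

lemma invertible_unip: "invertible (unip m w n)"
  unfolding invertible_def
  \<comment> \<open>The middle entry w' of the inverse solves w + w' + n m' = 0 with m' =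
    -m.\<close>
  by (intro exI[of _ "unip (- m) (n * m - w) (- n)"]) (simp add: unip_mult unip_0)

lemma unip_eqI:
  fixes B :: "int ^ 3 ^ 3"
  assumes "\<And>x y z. B *v vector [x, y, z] = vector [x, m * x + y, w * x + n * y + z]"
  shows "B = unip m w n"
  using assms[of 1 0 0] assms[of 0 1 0] assms[of 0 0 1]
  by (simp add: unip_def matrix_vector_mult_def vec_eq_iff forall_3 sum_3)

lemma abs_torus3_eq_iff: "abs_torus3 x = abs_torus3 y \<longleftrightarrow> (\<forall>i. x $ i - y $ i \<in> \<int>)"
  by (simp add: torus3.abs_eq_iff torus_rel_def)

lemma abs_torus3_cases: obtains p where "x = abs_torus3 p"
  by (metis Quotient_abs_rep[OF Quotient_torus3])

lemma torus_mult_add: "torus_mult B (x + y) = torus_mult B x + torus_mult B y"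
  by transfer (simp add: matrix_vector_right_distrib torus_rel_def)

lemma torus_mult_mat_1: "torus_mult (mat 1) x = x"
proof (transfer, goal_cases)
  case (1 x)
  have "real_matrix (mat 1) = mat 1"
    by (simp add: real_matrix_def mat_def vec_eq_iff)
  then show ?case by (simp add: torus_rel_def)
qed

lemma real_matrix_mult: "real_matrix (B ** C) = real_matrix B ** real_matrix C"
  by (simp add: real_matrix_def matrix_matrix_mult_def vec_eq_iff)

lemma torus_mult_mult: "torus_mult (B ** C) x = torus_mult B (torus_mult C x)"
  by transfer (simp add: real_matrix_mult matrix_vector_mul_assoc torus_rel_def)

lemma open_torus_mult_vimage:
  assumes "open U"
  shows "open (torus_mult B -` U)"
proof -
  have "abs_torus3 -` torus_mult B -` U = (*v) (real_matrix B) -` (abs_torus3 -` U)"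
    by (auto simp: torus_mult.abs_eq)
  moreover have "open (\<dots>)"
    using assms by (intro open_vimage[OF _ linear_continuous_on]) (auto simp: open_torus3_def)
  ultimately show ?thesis
    by (simp add: open_torus3_def)
qed

lemma minimal_action_iff:
  "minimal_action \<psi> \<longleftrightarrow> (\<forall>x U. open U \<longrightarrow> U \<noteq> {} \<longrightarrow> (\<exists>l. \<psi> l x \<in> U))"
proof -
  have "closure S = UNIV \<longleftrightarrow> (\<forall>U. open U \<longrightarrow> U \<noteq> {} \<longrightarrow> S \<inter> U \<noteq> {})" for S :: "torus3 set"
  proof
    assume "closure S = UNIV"
    then show "\<forall>U. open U \<longrightarrow> U \<noteq> {} \<longrightarrow> S \<inter> U \<noteq> {}"
      using open_Int_closure_eq_empty[of _ S] by (auto simp: Int_commute)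
  next
    assume *: "\<forall>U. open U \<longrightarrow> U \<noteq> {} \<longrightarrow> S \<inter> U \<noteq> {}"
    have "S \<inter> - closure S = {}"
      using closure_subset by blast
    then have "- closure S = {}"
      using * closed_closure[of S] by (metis open_Compl)
    then show "closure S = UNIV" by blast
  qed
  then have "closure S = UNIV \<longleftrightarrow> (\<forall>U. open U \<longrightarrow> U \<noteq> {} \<longrightarrow> (\<exists>s\<in>S. s \<in> U))" for S :: "torus3 set"
    by (simp only: disjoint_iff) blast
  then show ?thesis
    by (simp add: minimal_action_def)
qed

definition realizable :: "(int ^ 'p \<Rightarrow> int ^ 3 ^ 3) \<Rightarrow> bool" where
  "realizable A \<longleftrightarrow> (\<exists>\<psi> :: int ^ 'p \<Rightarrow> torus3 \<Rightarrow> torus3.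
      affine_action \<psi> \<and> minimal_action \<psi> \<and> free_action \<psi> \<and> induced_action \<psi> = A)"

text \<open>Conjugation by the torus automorphism \<open>Q\<close> changes the basis of the lattice.
  It is a homeomorphism, so minimality and freeness survive, and a translation part \<open>a\<close>
  becomes \<open>torus_mult R a\<close>.\<close>

lemma realizable_conj:
  fixes A A' :: "int ^ 'p \<Rightarrow> int ^ 3 ^ 3"
  assumes "realizable A'" "\<And>l. invertible (A l)" "R ** Q = mat 1" "Q ** R = mat 1"
    "\<And>l. A' l ** Q = Q ** A l"
  shows "realizable A"
proof -
  obtain \<psi>' where \<psi>': "affine_action \<psi>'" "minimal_action \<psi>'" "free_action \<psi>'" "induced_action \<psi>' = A'"
    using assms(1) unfolding realizable_def by blast
  have RQ: "torus_mult R (torus_mult Q x) = x" "torus_mult Q (torus_mult R x) = x" for x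
    by (simp_all add: torus_mult_mult[symmetric] assms(3,4) torus_mult_mat_1)
  define \<psi> where "\<psi> l x = torus_mult R (\<psi>' l (torus_mult Q x))" for l x
  have \<psi>_eq: "\<exists>a. \<psi> l = affine_map (A l) a" for l
  proof -
    obtain B a where B: "\<psi>' l = affine_map B a"
      using \<psi>'(1) unfolding affine_action_def affine_T3_def by blast
    then have "B = A' l"
      using fun_cong[OF \<psi>'(4), of l] by (simp add: induced_action_def)
    have "torus_mult R (torus_mult (A' l) (torus_mult Q x)) = torus_mult (A l) x" for x
      by (simp add: torus_mult_mult[symmetric] assms(5)) (simp add: torus_mult_mult RQ)
    then have "\<psi> l = affine_map (A l) (torus_mult R a)"
      using B \<open>B = A' l\<close> by (simp add: fun_eq_iff \<psi>_def affine_map_def torus_mult_add)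
    then show ?thesis by blast
  qed
  have "affine_action \<psi>"
    unfolding affine_action_def
  proof (intro conjI allI)
    show "\<psi> l \<in> affine_T3" for l
      using \<psi>_eq[of l] assms(2) by (auto simp: affine_T3_def)
    show "\<psi> 0 = id" "\<psi> (k + l) = \<psi> k \<circ> \<psi> l" for k l
      using \<psi>'(1) by (auto simp: affine_action_def \<psi>_def fun_eq_iff RQ)
  qed
  moreover have "minimal_action \<psi>"
    unfolding minimal_action_iff
  proof (intro allI impI)
    fix x and U :: "torus3 set" assume U: "open U" "U \<noteq> {}"
    then obtain u where "u \<in> U" by blast
    then have "torus_mult Q u \<in> torus_mult R -` U" by (simp add: RQ)
    then obtain l where "\<psi>' l (torus_mult Q x) \<in> torus_mult R -` U"
      using \<psi>'(2) open_torus_mult_vimage[OF U(1)] unfolding minimal_action_iff by blast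
    then show "\<exists>l. \<psi> l x \<in> U" by (auto simp: \<psi>_def)
  qed
  moreover have "free_action \<psi>"
    using \<psi>'(3) unfolding free_action_def \<psi>_def by (metis RQ)
  moreover have "induced_action \<psi> = A"
  proof
    fix l
    obtain a where "\<psi> l = affine_map (A l) a"
      using \<psi>_eq by blast
    then show "induced_action \<psi> l = A l"
      by (simp add: induced_action_def)
  qed
  ultimately show ?thesis
    unfolding realizable_def by blast
qed

section \<open>Lifting affine maps of the torus to real coordinates\<close>

definition pt :: "(real \<times> real) \<times> real \<Rightarrow> real ^ 3" where
  "pt p = vector [fst (fst p), snd (fst p), snd p]"

lemma pt_nth [simp]: "pt p $ 1 = fst (fst p)" "pt p $ 2 = snd (fst p)" "pt p $ 3 = snd p"
  by (simp_all add: pt_def)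

lemma torus3_cases:
  obtains u v w where "x = abs_torus3 (pt ((u, v), w))"
proof -
  obtain y where "x = abs_torus3 y"
    by (rule abs_torus3_cases)
  moreover have "y = pt ((y $ 1, y $ 2), y $ 3)"
    by (simp add: vec_eq_iff forall_3)
  ultimately show ?thesis
    using that by metis
qed

lemma continuous_pt: "continuous_on UNIV pt"
proof -
  have "pt = (\<lambda>p. \<chi> i. if i = 1 then fst (fst p) else if i = 2 then snd (fst p) else snd p)"
    by (simp add: fun_eq_iff vec_eq_iff forall_3)
  moreover have "continuous_on UNIV
    (\<lambda>p. (\<chi> i. if i = 1 then fst (fst p) else if i = 2 then snd (fst p) else snd p) :: real ^ 3)"
  proof (rule continuous_on_vec_lambda)
    fix i :: 3
    show "continuous_on UNIV (\<lambda>p :: (real \<times> real) \<times> real.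
      if i = 1 then fst (fst p) else if i = 2 then snd (fst p) else snd p)"
      by (cases "i = 1"; cases "i = 2") (auto intro!: continuous_intros)
  qed
  ultimately show ?thesis
    by (simp only:)
qed

lemma affine_map_pt:
  "affine_map (unip m w n) (abs_torus3 (pt ((a, b), c))) (abs_torus3 (pt p)) =
    abs_torus3 (pt (skew3 a m b w n c p))"
proof -
  have "real_matrix (unip m w n) *v pt p + pt ((a, b), c) = pt (skew3 a m b w n c p)"
    by (cases p)
      (auto simp: vec_eq_iff forall_3 real_matrix_def unip_def matrix_vector_mult_def sum_3 skew3_def)
  then show ?thesis
    by (simp add: affine_map_def torus_mult.abs_eq plus_torus3.abs_eq)
qed

lemma affine_map_funpow_pt:
  "(affine_map (unip m w n) (abs_torus3 (pt ((a, b), c))) ^^ k) (abs_torus3 (pt p)) =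
    abs_torus3 (pt ((skew3 a m b w n c ^^ k) p))"
  by (induction k) (simp_all add: affine_map_pt)

text \<open>The preimage of \<open>U\<close> in the cover contains a ball around some
  \<open>q\<close>. An iterate close to \<open>q\<close> modulo the lattice enters this ball after
  subtraction of a lattice vector, which does not move its image in the torus.\<close>

lemma minimal_affine_map:
  assumes "minimal_mod ((\<int> \<times> \<int>) \<times> \<int>) (skew3 a m b w n c)" "open U" "U \<noteq> {}"
  shows "\<exists>k. (affine_map (unip m w n) (abs_torus3 (pt ((a, b), c))) ^^ k) x \<in> U"
proof -
  obtain p where p: "x = abs_torus3 (pt p)"
    using torus3_cases by metis
  obtain q where q: "abs_torus3 (pt q) \<in> U"
    using assms(3) torus3_cases by (metis all_not_in_conv)
  have "open (pt -` (abs_torus3 -` U))"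
    using assms(2) by (intro open_vimage[OF _ continuous_pt]) (simp add: open_torus3_def)
  moreover have "q \<in> pt -` (abs_torus3 -` U)"
    using q by simp
  ultimately have "\<exists>e>0. \<forall>p'. dist p' q < e \<longrightarrow> p' \<in> pt -` (abs_torus3 -` U)"
    unfolding open_dist by blast
  then obtain e where e: "e > 0" "\<And>p'. dist p' q < e \<Longrightarrow> abs_torus3 (pt p') \<in> U"
    by auto
  obtain k where "near_mod ((\<int> \<times> \<int>) \<times> \<int>) e ((skew3 a m b w n c ^^ k) p) q"
    using assms(1) e(1) unfolding minimal_mod_def by blast
  then obtain d where d: "d \<in> (\<int> \<times> \<int>) \<times> \<int>" "norm ((skew3 a m b w n c ^^ k) p - q - d) < e"
    unfolding near_mod_def by blast
  let ?p = "(skew3 a m b w n c ^^ k) p"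
  have "abs_torus3 (pt (?p - d)) \<in> U"
    using d(2) by (intro e) (simp add: dist_norm algebra_simps)
  moreover have "abs_torus3 (pt (?p - d)) = abs_torus3 (pt ?p)"
    using d(1) by (auto simp: abs_torus3_eq_iff forall_3)
  ultimately show ?thesis
    using p by (auto simp: affine_map_funpow_pt)
qed

lemma affine_action_funpow:
  assumes "affine_action \<psi>"
  shows "\<exists>l'. \<psi> l' = \<psi> l ^^ k"
proof (induction k)
  case 0
  then show ?case using assms by (auto simp: affine_action_def intro!: exI[of _ 0])
next
  case (Suc k)
  then obtain l' where "\<psi> l' = \<psi> l ^^ k" by blast
  then have "\<psi> (l + l') = \<psi> l ^^ Suc k"
    using assms by (simp add: affine_action_def)
  then show ?case by blast
qed

text \<open>The equations for \<open>a\<close>, \<open>b\<close>, \<open>c\<close> make the lifts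
  \<open>skew3\<close> compose exactly on real space, not merely modulo the lattice. The hypothesis
  \<open>free\<close> excludes the coordinate equations of a fixed point. Minimality of one element
  suffices, since its powers belong to the action.\<close>

lemma realizable_unip:
  fixes \<mu> \<nu> \<omega> :: "int ^ 'p \<Rightarrow> int" and a b c :: "int ^ 'p \<Rightarrow> real"
  assumes \<mu>: "\<And>k l. \<mu> (k + l) = \<mu> k + \<mu> l"
    and \<nu>: "\<And>k l. \<nu> (k + l) = \<nu> k + \<nu> l"
    and \<omega>: "\<And>k l. \<omega> (k + l) = \<omega> k + \<omega> l + \<nu> k * \<mu> l"
    and a: "\<And>k l. a (k + l) = a k + a l"
    and b: "\<And>k l. b (k + l) = b k + b l + of_int (\<mu> k) * a l"
    and c: "\<And>k l. c (k + l) = c k + c l + of_int (\<omega> k) * a l + of_int (\<nu> k) * b l"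
    and free: "\<And>l x y. l \<noteq> 0 \<Longrightarrow> a l \<in> \<int> \<Longrightarrow> of_int (\<mu> l) * x + b l \<in> \<int> \<Longrightarrow>
      of_int (\<omega> l) * x + of_int (\<nu> l) * y + c l \<in> \<int> \<Longrightarrow> False"
    and minimal: "minimal_mod ((\<int> \<times> \<int>) \<times> \<int>)
      (skew3 (a l0) (\<mu> l0) (b l0) (\<omega> l0) (\<nu> l0) (c l0))"
  shows "realizable (\<lambda>l. unip (\<mu> l) (\<omega> l) (\<nu> l))"
proof -
  define \<psi> where "\<psi> l = affine_map (unip (\<mu> l) (\<omega> l) (\<nu> l)) (abs_torus3 (pt ((a l, b l), c l)))" for l
  have \<psi>: "\<psi> l (abs_torus3 (pt p)) =
      abs_torus3 (pt (skew3 (a l) (\<mu> l) (b l) (\<omega> l) (\<nu> l) (c l) p))" for l p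
    by (simp add: \<psi>_def affine_map_pt)
  have 0: "\<mu> 0 = 0" "\<nu> 0 = 0" "\<omega> 0 = 0" "a 0 = 0" "b 0 = 0" "c 0 = 0"
    using \<mu>[of 0 0] \<nu>[of 0 0] \<omega>[of 0 0] a[of 0 0] b[of 0 0] c[of 0 0] by auto
  have act: "affine_action \<psi>"
    unfolding affine_action_def
  proof (intro conjI allI)
    show "\<psi> l \<in> affine_T3" for l
      unfolding \<psi>_def affine_T3_def using invertible_unip by blast
    show "\<psi> 0 = id"
    proof
      fix x show "\<psi> 0 x = id x"
        by (rule torus3_cases[of x]) (simp add: \<psi> 0 skew3_def)
    qed
    show "\<psi> (k + l) = \<psi> k \<circ> \<psi> l" for k l
    proof
      fix x
      obtain u v w where "x = abs_torus3 (pt ((u, v), w))"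
        by (rule torus3_cases)
      moreover have "skew3 (a (k + l)) (\<mu> (k + l)) (b (k + l)) (\<omega> (k + l)) (\<nu> (k + l))
          (c (k + l)) ((u, v), w)
         = skew3 (a k) (\<mu> k) (b k) (\<omega> k) (\<nu> k) (c k)
          (skew3 (a l) (\<mu> l) (b l) (\<omega> l) (\<nu> l) (c l) ((u, v), w))"
        by (simp add: skew3_def a b c \<mu> \<nu> \<omega>) (simp add: algebra_simps)
      ultimately show "\<psi> (k + l) x = (\<psi> k \<circ> \<psi> l) x"
        by (simp add: \<psi>)
    qed
  qed
  moreover have "minimal_action \<psi>"
    unfolding minimal_action_iff
  proof (intro allI impI)
    fix x and U :: "torus3 set" assume "open U" "U \<noteq> {}"
    then obtain k where "(\<psi> l0 ^^ k) x \<in> U"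
      using minimal_affine_map[OF minimal] unfolding \<psi>_def by blast
    moreover obtain l' where "\<psi> l' = \<psi> l0 ^^ k"
      using affine_action_funpow[OF act] by blast
    ultimately show "\<exists>l. \<psi> l x \<in> U"
      by metis
  qed
  moreover have "free_action \<psi>"
    unfolding free_action_def
  proof (intro allI impI notI)
    fix l :: "int ^ 'p" assume "l \<noteq> 0" and "\<exists>x. \<psi> l x = x"
    then obtain x where "\<psi> l x = x" by blast
    moreover obtain u v w where "x = abs_torus3 (pt ((u, v), w))"
      by (rule torus3_cases)
    ultimately have "a l \<in> \<int>" "of_int (\<mu> l) * u + b l \<in> \<int>"
        "of_int (\<omega> l) * u + of_int (\<nu> l) * v + c l \<in> \<int>"
      by (simp_all add: \<psi> abs_torus3_eq_iff forall_3 skew3_def algebra_simps)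
    then show False using free \<open>l \<noteq> 0\<close> by blast
  qed
  moreover have "induced_action \<psi> = (\<lambda>l. unip (\<mu> l) (\<omega> l) (\<nu> l))"
    by (simp add: induced_action_def \<psi>_def)
  ultimately show ?thesis
    unfolding realizable_def by blast
qed

section \<open>Rationally independent families\<close>

text \<open>For each integer relation, at most one value of the new number satisfies it, so only
  countably many values are excluded.\<close>

lemma ex_indep_mod1: "\<exists>\<theta>. indep_mod1 n \<theta>"
proof (induction n)
  case 0
  then show ?case by (simp add: indep_mod1_def)
next
  case (Suc n)
  then obtain \<theta> where \<theta>: "indep_mod1 n \<theta>" by blast
  \<comment> \<open>Coefficient vectors are encoded as lists because functions on \<open>nat\<close>
    form an uncountable type. Lists with last coefficient zero contribute only the value 0, as
    division by zero gives 0.\<close>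
  define B where "B = (\<lambda>(m :: int, c :: int list).
    (of_int m - (\<Sum>i<n. of_int (c ! i) * \<theta> i)) / of_int (c ! n)) ` UNIV"
  have "countable B"
    unfolding B_def by (intro countable_image) simp
  then obtain t where t: "t \<notin> B"
    using uncountable_UNIV_real by (metis UNIV_eq_I)
  have "indep_mod1 (Suc n) (\<theta>(n := t))"
    unfolding indep_mod1_def
  proof (intro allI impI)
    fix c :: "nat \<Rightarrow> int" and i
    assume *: "(\<Sum>i<Suc n. of_int (c i) * (\<theta>(n := t)) i) \<in> \<int>" and "i < Suc n"
    have eq: "(\<Sum>i<Suc n. of_int (c i) * (\<theta>(n := t)) i)
        = (\<Sum>i<n. of_int (c i) * \<theta> i) + of_int (c n) * t"
      by simp
    with * obtain m where m: "(\<Sum>i<n. of_int (c i) * \<theta> i) + of_int (c n) * t = of_int m"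
      by (metis Ints_cases)
    have "c n = 0"
    proof (rule ccontr)
      assume "c n \<noteq> 0"
      define cs where "cs = map c [0..<Suc n]"
      have "cs ! i = c i" if "i \<le> n" for i
        using that by (simp add: cs_def del: upt_Suc)
      then have "(\<Sum>i<n. of_int (cs ! i) * \<theta> i) = (\<Sum>i<n. of_int (c i) * \<theta> i)" "cs ! n = c n"
        by (auto intro: sum.cong)
      then have "t = (of_int m - (\<Sum>i<n. of_int (cs ! i) * \<theta> i)) / of_int (cs ! n)"
        using m \<open>c n \<noteq> 0\<close> by (simp add: field_simps)
      then have "t \<in> B"
        unfolding B_def by (intro image_eqI[of _ _ "(m, cs)"]) auto
      with t show False by blast
    qed
    then have "\<forall>i<n. c i = 0"
      using \<theta> m unfolding indep_mod1_def by simp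
    with \<open>c n = 0\<close> show "c i = 0"
      using \<open>i < Suc n\<close> less_Suc_eq by auto
  qed
  then show ?case by blast
qed

lemma ex_indep_family:
  "\<exists>f :: 'a::finite \<Rightarrow> real. \<forall>c :: 'a \<Rightarrow> int. (\<Sum>i\<in>UNIV. of_int (c i) * f i) \<in> \<int> \<longrightarrow> (\<forall>i. c i = 0)"
proof -
  define n where "n = CARD('a)"
  obtain \<theta> where \<theta>: "indep_mod1 n \<theta>"
    using ex_indep_mod1 by blast
  obtain h :: "nat \<Rightarrow> 'a" where h: "bij_betw h {..<n} UNIV"
    unfolding n_def using ex_bij_betw_nat_finite[of "UNIV :: 'a set"] by (auto simp: atLeast0LessThan)
  define g where "g = inv_into {..<n} h"
  have gh: "g (h i) = i" if "i < n" for i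
    using h that by (simp add: g_def bij_betw_inv_into_left)
  show ?thesis
  proof (intro exI[of _ "\<theta> \<circ> g"] allI impI)
    fix c :: "'a \<Rightarrow> int" and j assume *: "(\<Sum>i\<in>UNIV. of_int (c i) * (\<theta> \<circ> g) i) \<in> \<int>"
    have "(\<Sum>i\<in>UNIV. of_int (c i) * (\<theta> \<circ> g) i) = (\<Sum>i<n. of_int (c (h i)) * (\<theta> \<circ> g) (h i))"
      by (rule sum.reindex_bij_betw[OF h, symmetric])
    also have "\<dots> = (\<Sum>i<n. of_int (c (h i)) * \<theta> i)"
      by (rule sum.cong) (auto simp: gh)
    finally have "(\<Sum>i<n. of_int (c (h i)) * \<theta> i) \<in> \<int>"
      using * by simp
    then have "\<forall>i<n. c (h i) = 0"
      using spec[OF \<theta>[unfolded indep_mod1_def], of "\<lambda>i. c (h i)"] by blast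
    moreover obtain i where "i < n" "j = h i"
      using h unfolding bij_betw_def by (metis UNIV_I imageE lessThan_iff)
    ultimately show "c j = 0" by simp
  qed
qed

text \<open>A single independent family indexed by \<open>'p \<times> 3\<close> splits into three
  jointly independent ones.\<close>

lemma ex_indep_triple:
  "\<exists>(f :: 'p::finite \<Rightarrow> real) (g :: 'p \<Rightarrow> real) (h :: 'p \<Rightarrow> real). \<forall>x y z :: 'p \<Rightarrow> int.
    (\<Sum>i\<in>UNIV. of_int (x i) * f i) + (\<Sum>i\<in>UNIV. of_int (y i) * g i)
    + (\<Sum>i\<in>UNIV. of_int (z i) * h i) \<in> \<int> \<longrightarrow> (\<forall>i. x i = 0) \<and> (\<forall>i. y i = 0) \<and> (\<forall>i. z i = 0)"
proof -
  obtain F :: "'p \<times> 3 \<Rightarrow> real" where F: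
    "\<And>c :: 'p \<times> 3 \<Rightarrow> int. (\<Sum>i\<in>UNIV. of_int (c i) * F i) \<in> \<int> \<Longrightarrow> (\<forall>i. c i = 0)"
    using ex_indep_family by metis
  show ?thesis
  proof (rule exI[of _ "\<lambda>i. F (i, 1)"], rule exI[of _ "\<lambda>i. F (i, 2)"], rule exI[of _ "\<lambda>i. F (i, 3)"],
      intro allI impI)
    fix x y z :: "'p \<Rightarrow> int"
    assume *: "(\<Sum>i\<in>UNIV. of_int (x i) * F (i, 1)) + (\<Sum>i\<in>UNIV. of_int (y i) * F (i, 2))
      + (\<Sum>i\<in>UNIV. of_int (z i) * F (i, 3)) \<in> \<int>"
    define c where "c = (\<lambda>(i, j :: 3). if j = 1 then x i else if j = 2 then y i else z i)"
    have "(\<Sum>i\<in>UNIV. of_int (c i) * F i) = (\<Sum>i\<in>UNIV. \<Sum>j\<in>UNIV. of_int (c (i, j)) * F (i, j))"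
      by (simp add: sum.cartesian_product)
    also have "\<dots> = (\<Sum>i\<in>UNIV. of_int (x i) * F (i, 1)) + (\<Sum>i\<in>UNIV. of_int (y i) * F (i, 2))
      + (\<Sum>i\<in>UNIV. of_int (z i) * F (i, 3))"
      by (simp add: sum_3 c_def sum.distrib)
    finally have "\<forall>i. c i = 0"
      using F[of c] * by simp
    then have "c (i, 1) = 0" "c (i, 2) = 0" "c (i, 3) = 0" for i
      by blast+
    then show "(\<forall>i. x i = 0) \<and> (\<forall>i. y i = 0) \<and> (\<forall>i. z i = 0)"
      by (simp add: c_def)
  qed
qed

section \<open>Generic homomorphisms from \<open>int ^ 'p\<close> to the reals\<close>

definition dot :: "('p::finite \<Rightarrow> real) \<Rightarrow> int ^ 'p \<Rightarrow> real" where
  "dot f l = (\<Sum>i\<in>UNIV. of_int (l $ i) * f i)"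

lemma dot_add: "dot f (k + l) = dot f k + dot f l"
  by (simp add: dot_def distrib_right sum.distrib)

text \<open>This supplies the generic coefficients of the constructions: each homomorphism is
  injective modulo 1, and values of different ones satisfy no nontrivial integer relation.\<close>

lemma ex_indep_dots:
  "\<exists>(f :: 'p::finite \<Rightarrow> real) (g :: 'p \<Rightarrow> real) (h :: 'p \<Rightarrow> real). \<forall>x y z :: int ^ 'p.
    dot f x + dot g y + dot h z \<in> \<int> \<longrightarrow> x = 0 \<and> y = 0 \<and> z = 0"
proof -
  obtain f g h :: "'p \<Rightarrow> real" where *: "\<forall>x y z :: 'p \<Rightarrow> int.
      (\<Sum>i\<in>UNIV. of_int (x i) * f i) + (\<Sum>i\<in>UNIV. of_int (y i) * g i)
    + (\<Sum>i\<in>UNIV. of_int (z i) * h i) \<in> \<int> \<longrightarrow> (\<forall>i. x i = 0) \<and> (\<forall>i. y i = 0) \<and> (\<forall>i. z i = 0)"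
    using ex_indep_triple by blast
  show ?thesis
    unfolding dot_def vec_eq_iff zero_index
    by (rule exI[of _ f], rule exI[of _ g], rule exI[of _ h]) (intro allI impI, rule *[rule_format])
qed

lemma dot_zero: "dot f 0 = 0"
  by (simp add: dot_def)

lemma dot_axis: "dot f (axis i m) = of_int m * f i"
  by (simp add: dot_def axis_def if_distrib if_distribR cong: if_cong)

lemma dot_smult: "of_int x * dot f l = dot f (x *s l)"
  by (simp add: dot_def sum_distrib_left mult.assoc)

lemma axis_eq_0: "axis i m = (0 :: int ^ 'p) \<longleftrightarrow> m = 0"
  by (simp add: axis_def vec_eq_iff)

section \<open>Realizable and non-realizable actions\<close>

text \<open>Commutativity makes \<mu> a rational multiple of \<nu>, and \<omega> becomes a
  homomorphism after a quadratic correction. The cocycle equations then have polynomial solutions in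
  \<nu> and this homomorphism, with the generic term \<open>dot h\<close> added in the last
  coordinate for freeness.\<close>

lemma realizable_nu_nonzero:
  fixes \<mu> \<nu> \<omega> :: "int ^ 'p \<Rightarrow> int"
  assumes \<mu>: "\<And>k l. \<mu> (k + l) = \<mu> k + \<mu> l"
    and \<nu>: "\<And>k l. \<nu> (k + l) = \<nu> k + \<nu> l"
    and \<omega>: "\<And>k l. \<omega> (k + l) = \<omega> k + \<omega> l + \<nu> k * \<mu> l"
    and l0: "\<nu> l0 \<noteq> 0"
  shows "realizable (\<lambda>l. unip (\<mu> l) (\<omega> l) (\<nu> l))"
proof -
  obtain f g h :: "'p \<Rightarrow> real" where
    indep [rule_format]: "\<forall>x y z :: int ^ 'p. dot f x + dot g y + dot h z \<in> \<int> \<longrightarrow>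
      x = 0 \<and> y = 0 \<and> z = 0"
    using ex_indep_dots by blast
  \<comment> \<open>Any index will do: it provides two scalars that are independent modulo
    1.\<close>
  obtain i0 :: 'p where True by simp
  define \<alpha> where "\<alpha> = f i0"
  define \<beta> where "\<beta> = g i0"
  have \<alpha>\<beta>: "x = 0 \<and> y = 0" if "of_int x * \<alpha> + of_int y * \<beta> \<in> \<int>" for x y :: int
    using indep[of "axis i0 x" "axis i0 y" 0] that
    by (simp add: dot_axis dot_zero axis_eq_0 \<alpha>_def \<beta>_def)
  have h: "l = 0" if "dot h l \<in> \<int>" for l
    using indep[of 0 0 l] that by (simp add: dot_zero)
  define r :: real where "r = of_int (\<mu> l0) / of_int (\<nu> l0)"
  have r: "of_int (\<mu> l) = r * of_int (\<nu> l)" for l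
  proof -
    have "\<nu> l * \<mu> l0 = \<nu> l0 * \<mu> l"
      using \<omega>[of l l0] \<omega>[of l0 l] by (simp add: add.commute)
    then have "real_of_int (\<nu> l) * of_int (\<mu> l0) = of_int (\<nu> l0) * of_int (\<mu> l)"
      by (metis of_int_mult)
    then show ?thesis
      using l0 by (simp add: r_def field_simps)
  qed
  define n where "n l = real_of_int (\<nu> l)" for l
  \<comment> \<open>The defect of additivity of \<omega> is r \<nu>(k) \<nu>(l), the polarization of
    r \<nu>^2 / 2, so subtracting that square leaves a homomorphism.\<close>
  define \<eta> where "\<eta> l = of_int (\<omega> l) - r * n l ^ 2 / 2" for l
  have n: "n (k + l) = n k + n l" for k l
    by (simp add: n_def \<nu>)
  have m: "of_int (\<mu> l) = r * n l" for l
    by (simp add: n_def r)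
  have w: "of_int (\<omega> l) = \<eta> l + r * n l ^ 2 / 2" for l
    by (simp add: \<eta>_def)
  have \<eta>: "\<eta> (k + l) = \<eta> k + \<eta> l" for k l
    by (simp add: \<eta>_def \<omega> m n n_def[symmetric] power2_eq_square algebra_simps add_divide_distrib)
  \<comment> \<open>\<open>b\<close> and \<open>c\<close> solve the cocycle equations; the term \<open>\<alpha> \<eta>\<close> in \<open>b\<close> makes
    \<open>\<omega>(k) a(l) + \<nu>(k) b(l)\<close> symmetric in \<open>k\<close> and \<open>l\<close>.\<close>
  define a where "a l = \<alpha> * n l" for l
  define b where "b l = \<alpha> * r * n l ^ 2 / 2 + \<alpha> * \<eta> l + \<beta> * n l" for l
  define c where "c l = r * \<alpha> * n l ^ 3 / 6 + \<alpha> * \<eta> l * n l + \<beta> * n l ^ 2 / 2 + dot h l" for l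
  show ?thesis
  proof (rule realizable_unip[OF \<mu> \<nu> \<omega>, where a=a and b=b and c=c and ?l0.0=l0])
    show "a (k + l) = a k + a l" for k l
      by (simp add: a_def n algebra_simps)
    show "b (k + l) = b k + b l + of_int (\<mu> k) * a l" for k l
      by (simp add: b_def a_def n \<eta> m power2_eq_square field_simps)
    show "c (k + l) = c k + c l + of_int (\<omega> k) * a l + of_int (\<nu> k) * b l" for k l
      unfolding w n_def[symmetric]
      by (simp add: c_def a_def b_def n \<eta> dot_add power2_eq_square power3_eq_cube field_simps)
  next
    fix l :: "int ^ 'p" and x y :: real
    assume l: "l \<noteq> 0" and a: "a l \<in> \<int>" and b: "of_int (\<mu> l) * x + b l \<in> \<int>"
      and c: "of_int (\<omega> l) * x + of_int (\<nu> l) * y + c l \<in> \<int>"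
    \<comment> \<open>The fixed-point equations are used in order: the first gives
      \<open>\<nu> l = 0\<close>, the second then reduces to \<alpha> \<omega>(l) and gives
      \<open>\<omega> l = 0\<close>, and the third reduces to \<open>dot h l\<close>.\<close>
    have "\<nu> l = 0"
      using \<alpha>\<beta>[of "\<nu> l" 0] a by (simp add: a_def n_def mult.commute)
    then have n0: "n l = 0" and "\<mu> l = 0"
      using m[of l] by (simp_all add: n_def)
    then have "of_int (\<omega> l) * \<alpha> \<in> \<int>"
      using b w[of l] by (simp add: b_def mult.commute)
    then have "\<omega> l = 0"
      using \<alpha>\<beta>[of "\<omega> l" 0] by simp
    then have "dot h l \<in> \<int>"
      using c w[of l] n0 \<open>\<nu> l = 0\<close> by (simp add: c_def)
    then show False
      using h l by blast
  next
    have "minimal_mod (\<int> \<times> \<int>) (skew2 (a l0) (\<mu> l0) (b l0))"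
    proof (cases "\<mu> l0 = 0")
      case False
      have "x = 0" if "of_int x * a l0 \<in> \<int>" for x :: int
        using \<alpha>\<beta>[of "x * \<nu> l0" 0] that l0
        by (simp add: a_def n_def mult.assoc mult.left_commute mult.commute)
      then show ?thesis
        by (rule minimal_skew2) (use False in auto)
    next
      case True
      then have "r = 0" by (simp add: r_def)
      \<comment> \<open>Here the base is a rotation. The term with \<beta> keeps \<open>b l0\<close>
        from being a rational multiple of \<open>a l0\<close>.\<close>
      have "x = 0 \<and> y = 0" if *: "of_int x * a l0 + of_int y * b l0 \<in> \<int>" for x y :: int
      proof -
        have "of_int x * a l0 + of_int y * b l0
            = of_int (x * \<nu> l0 + y * \<omega> l0) * \<alpha> + of_int (y * \<nu> l0) * \<beta>"
          using w[of l0] by (simp add: a_def b_def n_def \<open>r = 0\<close> algebra_simps)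
        then have "x * \<nu> l0 + y * \<omega> l0 = 0 \<and> y * \<nu> l0 = 0"
          using \<alpha>\<beta> * by metis
        then show ?thesis using l0 by auto
      qed
      then have "minimal_mod (\<int> \<times> \<int>) (\<lambda>v. v + (a l0, b l0))"
        by (rule minimal_translation2)
      moreover have "skew2 (a l0) (\<mu> l0) (b l0) = (\<lambda>v. v + (a l0, b l0))"
        using True by (auto simp: skew2_def)
      ultimately show ?thesis by simp
    qed
    then show "minimal_mod ((\<int> \<times> \<int>) \<times> \<int>)
      (skew3 (a l0) (\<mu> l0) (b l0) (\<omega> l0) (\<nu> l0) (c l0))"
      by (rule minimal_skew3) (use l0 in auto)
  qed
qed

text \<open>If \<omega> vanishes, generic translations work. Otherwise choosing \<open>a\<close>
  proportional to \<omega> makes \<omega>(k) a(l) symmetric, and half the corresponding square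
  solves the cocycle equation for \<open>c\<close>. Freeness comes from the second coordinate, which
  is translated by the generic \<open>dot g\<close>.\<close>

lemma realizable_omega:
  fixes \<omega> :: "int ^ 'p \<Rightarrow> int"
  assumes \<omega>: "\<And>k l. \<omega> (k + l) = \<omega> k + \<omega> l"
  shows "realizable (\<lambda>l. unip 0 (\<omega> l) 0)"
proof -
  obtain f g h :: "'p \<Rightarrow> real" where
    indep [rule_format]: "\<forall>x y z :: int ^ 'p. dot f x + dot g y + dot h z \<in> \<int> \<longrightarrow>
      x = 0 \<and> y = 0 \<and> z = 0"
    using ex_indep_dots by blast
  have g: "l = 0" if "dot g l \<in> \<int>" for l
    using indep[of 0 l 0] that by (simp add: dot_zero)
  show ?thesis
  proof (cases "\<forall>l. \<omega> l = 0")
    case True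
    obtain i0 :: 'p where "True" by simp
    define l0 :: "int ^ 'p" where "l0 = axis i0 1"
    have l0: "l0 \<noteq> 0" by (simp add: l0_def axis_eq_0)
    show ?thesis
    proof (rule realizable_unip[where a="dot f" and b="dot g" and c="dot h" and ?l0.0=l0])
      have "x = 0 \<and> y = 0 \<and> z = 0"
        if "of_int x * dot f l0 + of_int y * dot g l0 + of_int z * dot h l0 \<in> \<int>" for x y z :: int
        using indep[of "x *s l0" "y *s l0" "z *s l0"] that l0 by (simp add: dot_smult)
      then have "minimal_mod ((\<int> \<times> \<int>) \<times> \<int>) (\<lambda>v. v + ((dot f l0, dot g l0), dot h l0))"
        by (rule minimal_translation3)
      moreover have "skew3 (dot f l0) 0 (dot g l0) (\<omega> l0) 0 (dot h l0)
        = (\<lambda>v. v + ((dot f l0, dot g l0), dot h l0))"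
        using True by (auto simp: skew3_def)
      ultimately show "minimal_mod ((\<int> \<times> \<int>) \<times> \<int>)
          (skew3 (dot f l0) 0 (dot g l0) (\<omega> l0) 0 (dot h l0))"
        by simp
    qed (use True in \<open>auto simp: dot_add dest: g\<close>)
  next
    case False
    then obtain l0 where l0: "\<omega> l0 \<noteq> 0" by blast
    have "l0 \<noteq> 0" using l0 \<omega>[of 0 0] by auto
    obtain i0 :: 'p where True by simp
    define \<alpha> where "\<alpha> = f i0"
    define a where "a l = \<alpha> * of_int (\<omega> l)" for l
    define c where "c l = \<alpha> * of_int (\<omega> l) ^ 2 / 2" for l
    show ?thesis
    proof (rule realizable_unip[where a=a and b="dot g" and c=c and ?l0.0=l0])
      have "x = 0 \<and> y = 0" if *: "of_int x * a l0 + of_int y * dot g l0 \<in> \<int>" for x y :: int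
      proof -
        have "of_int x * a l0 + of_int y * dot g l0
            = dot f (axis i0 (x * \<omega> l0)) + dot g (y *s l0) + dot h 0"
          by (simp add: dot_axis dot_smult dot_zero a_def \<alpha>_def algebra_simps)
        then have "axis i0 (x * \<omega> l0) = 0 \<and> y *s l0 = 0"
          using indep * by metis
        then show ?thesis
          using l0 \<open>l0 \<noteq> 0\<close> by (simp add: axis_eq_0)
      qed
      then have "minimal_mod (\<int> \<times> \<int>) (\<lambda>v. v + (a l0, dot g l0))"
        by (rule minimal_translation2)
      moreover have "skew2 (a l0) 0 (dot g l0) = (\<lambda>v. v + (a l0, dot g l0))"
        by (auto simp: skew2_def)
      ultimately have "minimal_mod (\<int> \<times> \<int>) (skew2 (a l0) 0 (dot g l0))"
        by simp
      then show "minimal_mod ((\<int> \<times> \<int>) \<times> \<int>) (skew3 (a l0) 0 (dot g l0) (\<omega> l0) 0 (c l0))"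
        by (rule minimal_skew3) (use l0 in auto)
      show "c (k + l) = c k + c l + of_int (\<omega> k) * a l + of_int 0 * dot g l" for k l
        by (simp add: c_def a_def \<omega> power2_eq_square field_simps)
    qed (auto simp: dot_add \<omega> a_def algebra_simps dest: g)
  qed
qed

text \<open>Clearing denominators and dividing by the gcd gives a primitive integer relation.
  Coprimality is what allows \<open>(s, t)\<close> to be completed to a unimodular matrix.\<close>

lemma coprime_relation:
  fixes \<mu> \<omega> :: "int ^ 'p \<Rightarrow> int"
  assumes "\<not> lin_indep_Q \<mu> \<omega>"
  obtains s t where "coprime s t" "\<And>l. s * \<mu> l + t * \<omega> l = 0"
proof -
  obtain a b :: rat where ab: "\<And>l. a * of_int (\<mu> l) + b * of_int (\<omega> l) = 0" "a \<noteq> 0 \<or> b \<noteq> 0"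
    using assms unfolding lin_indep_Q_def by blast
  obtain p q where pq: "a = of_int p / of_int q" "q > 0"
    using quotient_of_div quotient_of_denom_pos by (metis surj_pair)
  obtain p' q' where pq': "b = of_int p' / of_int q'" "q' > 0"
    using quotient_of_div quotient_of_denom_pos by (metis surj_pair)
  have rel: "p * q' * \<mu> l + p' * q * \<omega> l = 0" for l
  proof -
    have "(of_int (p * q' * \<mu> l + p' * q * \<omega> l) :: rat)
        = (a * of_int (\<mu> l) + b * of_int (\<omega> l)) * (of_int q * of_int q')"
      using pq(2) pq'(2) by (simp add: pq(1) pq'(1) field_simps)
    also have "\<dots> = 0"
      using ab(1) by simp
    finally show ?thesis
      by (simp only: of_int_eq_0_iff)
  qed
  have gcd: "gcd (p * q') (p' * q) \<noteq> 0"
    using ab(2) pq pq' by auto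
  then obtain s t where st: "p * q' = s * gcd (p * q') (p' * q)"
      "p' * q = t * gcd (p * q') (p' * q)" "coprime s t"
    using gcd_coprime_exists by blast
  have "gcd (p * q') (p' * q) * (s * \<mu> l + t * \<omega> l) = 0" for l
  proof -
    have "gcd (p * q') (p' * q) * (s * \<mu> l + t * \<omega> l)
        = (s * gcd (p * q') (p' * q)) * \<mu> l + (t * gcd (p * q') (p' * q)) * \<omega> l"
      by (simp add: distrib_left ac_simps)
    also have "\<dots> = 0"
      using rel[of l] by (simp only: st(1,2)[symmetric])
    finally show ?thesis .
  qed
  then have "s * \<mu> l + t * \<omega> l = 0" for l
    using gcd by (metis mult_eq_0_iff)
  then show ?thesis
    using that st(3) by blast
qed

text \<open>The relation \<open>s \<mu> + t \<omega> = 0\<close> becomes \<open>\<mu> = 0\<close> in the basis adapted to \<open>s y + t z\<close>.\<close>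

lemma realizable_dependent:
  fixes \<mu> \<omega> :: "int ^ 'p \<Rightarrow> int"
  assumes \<mu>: "\<And>k l. \<mu> (k + l) = \<mu> k + \<mu> l"
    and \<omega>: "\<And>k l. \<omega> (k + l) = \<omega> k + \<omega> l"
    and "\<not> lin_indep_Q \<mu> \<omega>"
  shows "realizable (\<lambda>l. unip (\<mu> l) (\<omega> l) 0)"
proof -
  obtain s t where st: "coprime s t" "\<And>l. s * \<mu> l + t * \<omega> l = 0"
    using coprime_relation[OF assms(3)] by metis
  obtain u v where uv: "u * s + v * t = 1"
    using bezout_int[of s t] st(1) by (metis coprime_imp_gcd_eq_1)
  \<comment> \<open>The new coordinates are s y + t z and -v y + u z, with determinant u s + v t =
    1; \<open>R\<close> is the inverse change of basis.\<close>
  define Q :: "int ^ 3 ^ 3" where "Q = vector [vector [1, 0, 0], vector [0, s, t], vector [0, - v, u]]"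
  define R :: "int ^ 3 ^ 3" where "R = vector [vector [1, 0, 0], vector [0, u, - t], vector [0, v, s]]"
  \<comment> \<open>This is the coefficient of x in the motion of -v y + u z. The coefficient for s
    y + t z is s \<mu> + t \<omega>, which vanishes.\<close>
  define \<theta> where "\<theta> l = u * \<omega> l - v * \<mu> l" for l
  show ?thesis
  proof (rule realizable_conj[where A'="\<lambda>l. unip 0 (\<theta> l) 0" and Q=Q and R=R])
    show "realizable (\<lambda>l. unip 0 (\<theta> l) 0)"
      by (rule realizable_omega) (simp add: \<theta>_def \<mu> \<omega> algebra_simps)
    show "R ** Q = mat 1" "Q ** R = mat 1"
      using uv
      by (auto simp: Q_def R_def mat_def matrix_matrix_mult_def vec_eq_iff forall_3 sum_3 algebra_simps)
    show "unip 0 (\<theta> l) 0 ** Q = Q ** unip (\<mu> l) (\<omega> l) 0" for l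
      using st(2)[of l]
      by (auto simp: Q_def unip_def \<theta>_def matrix_matrix_mult_def vec_eq_iff forall_3 sum_3)
  qed (rule invertible_unip)
qed

text \<open>For a fixed nonzero integer \<open>D\<close>, every translation part has first
  coordinate in (1/D)\<int>, so the orbit of 0 never enters the nonempty open set where
  \<open>D\<close> times the first coordinate is not an integer.\<close>

lemma not_realizable_independent:
  fixes \<mu> \<omega> :: "int ^ 'p \<Rightarrow> int"
  assumes "lin_indep_Q \<mu> \<omega>"
  shows "\<not> realizable (\<lambda>l. unip (\<mu> l) (\<omega> l) 0)"
proof
  assume "realizable (\<lambda>l. unip (\<mu> l) (\<omega> l) 0)"
  then obtain \<psi> where \<psi>: "affine_action \<psi>" "minimal_action \<psi>"
      "induced_action \<psi> = (\<lambda>l. unip (\<mu> l) (\<omega> l) 0)"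
    unfolding realizable_def by blast
  have "\<exists>v. \<psi> l = affine_map (unip (\<mu> l) (\<omega> l) 0) (abs_torus3 (pt v))" for l
  proof -
    obtain B a where B: "\<psi> l = affine_map B a"
      using \<psi>(1) unfolding affine_action_def affine_T3_def by blast
    then have "B = unip (\<mu> l) (\<omega> l) 0"
      using fun_cong[OF \<psi>(3), of l] by (simp add: induced_action_def)
    then show ?thesis
      using B torus3_cases[of a] by metis
  qed
  then obtain v where v: "\<And>l. \<psi> l = affine_map (unip (\<mu> l) (\<omega> l) 0) (abs_torus3 (pt (v l)))"
    by metis
  define a where "a l = fst (fst (v l))" for l
  \<comment> \<open>Both orders of composition are evaluated at 0. In the second and third
    coordinates the translation parts cancel, leaving only the linear action on the first
    coordinates.\<close>
  have comm: "of_int (\<mu> k) * a l - of_int (\<mu> l) * a k \<in> \<int> \<and>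
      of_int (\<omega> k) * a l - of_int (\<omega> l) * a k \<in> \<int>" for k l
  proof -
    have "\<psi> k \<circ> \<psi> l = \<psi> l \<circ> \<psi> k"
      using \<psi>(1) unfolding affine_action_def by (metis add.commute)
    then have "\<psi> k (\<psi> l (abs_torus3 (pt 0))) = \<psi> l (\<psi> k (abs_torus3 (pt 0)))"
      by (metis comp_apply)
    moreover obtain b c b' c' where "v k = ((a k, b), c)" "v l = ((a l, b'), c')"
      unfolding a_def by (metis prod.collapse)
    ultimately have "(of_int (\<mu> k) * a l + b' + b) - (of_int (\<mu> l) * a k + b + b') \<in> \<int>"
        "(of_int (\<omega> k) * a l + c' + c) - (of_int (\<omega> l) * a k + c + c') \<in> \<int>"
      by (simp_all add: v affine_map_pt skew3_def zero_prod_def abs_torus3_eq_iff forall_3)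
    then show ?thesis by (simp add: algebra_simps)
  qed
  \<comment> \<open>If all these determinants vanished, \<open>\<omega> k\<close> and
    \<open>- \<mu> k\<close> would be the coefficients of a relation for every \<open>k\<close>.
    This forces \<mu> = 0, itself a relation with coefficients 1 and 0.\<close>
  have "\<exists>k l. \<mu> k * \<omega> l - \<mu> l * \<omega> k \<noteq> 0"
  proof (rule ccontr)
    assume "\<nexists>k l. \<mu> k * \<omega> l - \<mu> l * \<omega> k \<noteq> 0"
    then have 0: "\<omega> k * \<mu> l + - \<mu> k * \<omega> l = 0" for k l
      by (simp add: algebra_simps)
    have "\<mu> k = 0" for k
    proof -
      have "(of_int (\<omega> k) :: rat) * of_int (\<mu> l) + of_int (- \<mu> k) * of_int (\<omega> l) = 0" for l
        using 0[of k l] by (metis of_int_0 of_int_add of_int_mult)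
      then have "(of_int (- \<mu> k) :: rat) = 0"
        using assms unfolding lin_indep_Q_def by blast
      then show ?thesis by simp
    qed
    then have "(1 :: rat) * of_int (\<mu> l) + 0 * of_int (\<omega> l) = 0" for l
      by simp
    then have "(1 :: rat) = 0"
      using assms unfolding lin_indep_Q_def by blast
    then show False by simp
  qed
  then obtain k l where D: "\<mu> k * \<omega> l - \<mu> l * \<omega> k \<noteq> 0" by blast
  define D where "D = real_of_int (\<mu> k * \<omega> l - \<mu> l * \<omega> k)"
  have Da: "D * a m \<in> \<int>" for m
  proof -
    define M where "M j i = of_int (\<mu> j) * a i - of_int (\<mu> i) * a j" for j i
    define W where "W j i = of_int (\<omega> j) * a i - of_int (\<omega> i) * a j" for j i
    \<comment> \<open>This integer combination eliminates \<open>a k\<close> and \<open>a l\<close>,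
      as in Cramer's rule.\<close>
    have "D * a m = of_int (\<omega> l) * M k m - of_int (\<omega> k) * M l m - of_int (\<mu> m) * W k l"
      by (simp add: D_def M_def W_def algebra_simps)
    moreover have "M j i \<in> \<int>" "W j i \<in> \<int>" for j i
      using comm by (simp_all add: M_def W_def)
    ultimately show ?thesis by simp
  qed
  define S where "S = {x :: real ^ 3. D * x $ 1 \<notin> \<int>}"
  define U where "U = abs_torus3 ` S"
  \<comment> \<open>Since \<open>D\<close> is an integer, membership in \<open>S\<close> depends
    only on the class modulo the lattice.\<close>
  have S: "abs_torus3 -` U = S"
  proof -
    have "y \<in> S" if "x \<in> S" "abs_torus3 x = abs_torus3 y" for x y
    proof -
      have "D * (x $ 1 - y $ 1) \<in> \<int>"
        using that(2) unfolding D_def by (intro Ints_mult) (auto simp: abs_torus3_eq_iff)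
      then have "D * y $ 1 \<in> \<int> \<Longrightarrow> D * x $ 1 \<in> \<int>"
        using Ints_add by (fastforce simp: right_diff_distrib)
      then show ?thesis using that(1) by (auto simp: S_def)
    qed
    then show ?thesis by (auto simp: U_def)
  qed
  have "open S"
  proof -
    have "S = (\<lambda>x. D * x $ 1) -` (- \<int>)"
      by (auto simp: S_def)
    moreover have "open (- \<int> :: real set)"
      using closed_Ints by (simp add: open_Compl)
    ultimately show ?thesis
      by (simp add: open_vimage continuous_intros)
  qed
  then have "open U"
    by (simp add: open_torus3_def S)
  moreover have "D \<noteq> 0"
    using D unfolding D_def by (simp only: of_int_eq_0_iff not_False_eq_True)
  then have "pt ((1 / (2 * D), 0), 0) \<in> S"
    using Ints_nonzero_abs_less1[of "1 / 2 :: real"] by (auto simp: S_def)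
  then have "U \<noteq> {}" by (auto simp: U_def)
  ultimately obtain m where "\<psi> m (abs_torus3 (pt 0)) \<in> U"
    using \<psi>(2) unfolding minimal_action_iff by blast
  moreover have "\<psi> m (abs_torus3 (pt 0)) = abs_torus3 (pt (v m))"
    using affine_map_pt[of "\<mu> m" "\<omega> m" 0 "fst (fst (v m))" "snd (fst (v m))" "snd (v m)" 0]
    by (simp add: v skew3_def zero_prod_def)
  ultimately have "pt (v m) \<in> S"
    using S by auto
  then show False
    using Da[of m] by (simp add: S_def a_def)
qed

theorem mainTheorem4:
  fixes A :: "int ^ 'p \<Rightarrow> int ^ 3 ^ 3"
    and \<mu> \<nu> \<omega> :: "int ^ 'p \<Rightarrow> int"
  assumes "CARD('p) \<ge> 2"
    and "unipotent_action A"
    and "\<And>l x y z. A l *v vector [x, y, z] =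
      vector [x, \<mu> l * x + y, \<omega> l * x + \<nu> l * y + z]"
  shows "(\<exists>\<psi> :: int ^ 'p \<Rightarrow> torus3 \<Rightarrow> torus3.
      affine_action \<psi> \<and> minimal_action \<psi> \<and> free_action \<psi> \<and> induced_action \<psi> = A)
    \<longleftrightarrow> \<not> ((\<forall>l. \<nu> l = 0) \<and> lin_indep_Q \<mu> \<omega>)"
proof -
  have A: "A = (\<lambda>l. unip (\<mu> l) (\<omega> l) (\<nu> l))"
    by (intro ext unip_eqI assms(3))
  \<comment> \<open>Comparing the matrix entries of both sides yields the additivity of \<mu> and
    \<nu> and the twisted law for \<omega>.\<close>
  have "A (k + l) = A k ** A l" for k l
    using assms(2) by (simp add: unipotent_action_def linear_action_def)
  then have hom: "\<mu> (k + l) = \<mu> k + \<mu> l" "\<nu> (k + l) = \<nu> k + \<nu> l"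
    "\<omega> (k + l) = \<omega> k + \<omega> l + \<nu> k * \<mu> l" for k l
    by (simp_all add: A unip_mult unip_inject)
  have "realizable A \<longleftrightarrow> \<not> ((\<forall>l. \<nu> l = 0) \<and> lin_indep_Q \<mu> \<omega>)"
  proof (cases "\<forall>l. \<nu> l = 0")
    case True
    then have A0: "A = (\<lambda>l. unip (\<mu> l) (\<omega> l) 0)"
      by (simp add: A)
    show ?thesis
      using True hom not_realizable_independent[of \<mu> \<omega>] realizable_dependent[of \<mu> \<omega>]
      unfolding A0 by auto
  next
    case False
    then show ?thesis
      using realizable_nu_nonzero[OF hom] A by auto
  qed
  then show ?thesis
    by (simp add: realizable_def)
qed

end
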